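(* Let $C$ be an algebraically closed field of characteristic zero with the trivial derivation ($c'=0$ for all $c\in C$), and let $R(X)\in C(X)$ be a nonzero rational function in one variable $X$. The differential equation $Y'=R(Y)$ has a non constant solution which is liouvillian over $C$ if and only if there is an element $z\in C(X)$ such that $$\frac{1}{R(X)}=\frac{\partial z}{\partial X}\qquad\text{or}\qquad \frac{1}{R(X)}=\frac{1}{a z}\,\frac{\partial z}{\partial X}\ \text{ (with } z\neq 0)$$ for some nonzero element $a\in C$.
   Context: A differential field is a field with a derivation $'$. A differential field extension $E$ of $C$ is a liouvillian extension of $C$ if $E=C(t_1,\dots,t_n)$ and there is a tower of differential fields $C=k_0\subset k_1\subset\cdots\subset k_n=E$ such that for each $i$, $k_i=k_{i-1}(t_i)$ and either $t_i'\in k_{i-1}$, or $t_i'/t_i\in k_{i-1}$ (with $t_i\neq 0$), or $t_i$ is algebraic over $k_{i-1}$. A solution of a differential equation is liouvillian over $C$ if it belongs to some liouvillian extension of $C$; it is non constant if its derivative is nonzero. $\partial/\partial X$ is the usual derivation of $C(X)$ that is trivial on $C$ and sends $X$ to $1$. *)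

theory Defs
  imports
    "HOL-Algebra.Algebraic_Closure_Type"
    "HOL-Algebra.Generated_Fields"
    "HOL-Computational_Algebra.Computational_Algebra"
begin

section \<open>Differential fields and liouvillian extensions\<close>

locale differential_field = field F for F (structure) and der +
  assumes der_closed: "x \<in> carrier F \<Longrightarrow> der x \<in> carrier F"
    and der_add: "\<lbrakk>x \<in> carrier F; y \<in> carrier F\<rbrakk> \<Longrightarrow> der (x \<oplus> y) = der x \<oplus> der y"
    and der_mult: "\<lbrakk>x \<in> carrier F; y \<in> carrier F\<rbrakk>
      \<Longrightarrow> der (x \<otimes> y) = der x \<otimes> y \<oplus> x \<otimes> der y"

text \<open>An extension \<open>E\<close> of \<open>K\<close> comes with an embedding \<open>\<iota>\<close>, since the two carriers
  may live in different types; the copy of \<open>K\<close> inside \<open>E\<close> is \<open>\<iota> ` carrier K\<close>.\<close>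

definition differential_extension ::
    "'k ring \<Rightarrow> ('k \<Rightarrow> 'k) \<Rightarrow> 'e ring \<Rightarrow> ('e \<Rightarrow> 'e) \<Rightarrow> ('k \<Rightarrow> 'e) \<Rightarrow> bool" where
  "differential_extension K d E D \<iota> \<longleftrightarrow>
     differential_field K d \<and> differential_field E D \<and> \<iota> \<in> ring_hom K E \<and>
     (\<forall>c\<in>carrier K. D (\<iota> c) = \<iota> (d c))"

definition differential_subfield :: "'e set \<Rightarrow> 'e ring \<Rightarrow> ('e \<Rightarrow> 'e) \<Rightarrow> bool" where
  "differential_subfield S E D \<longleftrightarrow> subfield S E \<and> D ` S \<subseteq> S"

definition liouvillian_generator :: "'e ring \<Rightarrow> ('e \<Rightarrow> 'e) \<Rightarrow> 'e set \<Rightarrow> 'e \<Rightarrow> bool" where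
  "liouvillian_generator E D S t \<longleftrightarrow>
     D t \<in> S \<or>
     (t \<noteq> \<zero>\<^bsub>E\<^esub> \<and> D t \<otimes>\<^bsub>E\<^esub> inv\<^bsub>E\<^esub> t \<in> S) \<or>
     ((ring.algebraic E) over S) t"

definition liouvillian_extension ::
    "'k ring \<Rightarrow> ('k \<Rightarrow> 'k) \<Rightarrow> 'e ring \<Rightarrow> ('e \<Rightarrow> 'e) \<Rightarrow> ('k \<Rightarrow> 'e) \<Rightarrow> bool" where
  "liouvillian_extension K d E D \<iota> \<longleftrightarrow>
     differential_extension K d E D \<iota> \<and>
     (\<exists>(n::nat) (t :: nat \<Rightarrow> 'e) (k :: nat \<Rightarrow> 'e set).
        carrier E = generate_field E (\<iota> ` carrier K \<union> t ` {1..n}) \<and>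
        k 0 = \<iota> ` carrier K \<and> k n = carrier E \<and>
        (\<forall>i\<le>n. differential_subfield (k i) E D) \<and>
        (\<forall>i\<in>{1..n}. k i = generate_field E (insert (t i) (k (i - 1))) \<and>
                     liouvillian_generator E D (k (i - 1)) (t i)))"


section \<open>Rational functions\<close>

text \<open>The field \<open>C(X)\<close> is the type \<open>'c poly fract\<close>.\<close>

abbreviation const_rat :: "'c::field \<Rightarrow> 'c poly fract" where
  "const_rat a \<equiv> Fraction_Field.Fract [:a:] 1"

definition rat_deriv :: "'c::field poly fract \<Rightarrow> 'c poly fract" where
  "rat_deriv f = (THE g. \<exists>p q. f = Fraction_Field.Fract p q \<and> q \<noteq> 0 \<and>
     g = Fraction_Field.Fract (pderiv p * q - p * pderiv q) (q * q))"

lemma rat_deriv_Fract: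
  fixes p q :: "'c::field poly"
  assumes "q \<noteq> 0"
  shows "rat_deriv (Fraction_Field.Fract p q) =
     Fraction_Field.Fract (pderiv p * q - p * pderiv q) (q * q)"
proof -
  have "Fraction_Field.Fract (pderiv r * s - r * pderiv s) (s * s) =
        Fraction_Field.Fract (pderiv p * q - p * pderiv q) (q * q)"
    if "Fraction_Field.Fract p q = Fraction_Field.Fract r s" "s \<noteq> 0" for r s
  proof -
    have eq: "p * s = r * q" using that assms by (simp add: eq_fract)
    have "pderiv p * s + p * pderiv s = pderiv r * q + r * pderiv q"
      using arg_cong[OF eq, of pderiv] by (simp add: pderiv_mult algebra_simps)
    then have eq': "pderiv r * q = pderiv p * s + p * pderiv s - r * pderiv q"
      by (simp add: algebra_simps)
    have "(pderiv r * s - r * pderiv s) * (q * q) =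
          (pderiv r * q) * (q * s) - (r * q) * (pderiv s * q)"
      by (simp only: ring_distribs ac_simps)
    also have "\<dots> = pderiv p * q * (s * s) - (r * q) * (pderiv q * s)"
      unfolding eq' eq[symmetric] using eq by (simp add: algebra_simps)
    also have "\<dots> = (pderiv p * q - p * pderiv q) * (s * s)"
      unfolding eq[symmetric] by (simp add: algebra_simps)
    finally have "(pderiv r * s - r * pderiv s) * (q * q) = (pderiv p * q - p * pderiv q) * (s * s)" .
    with that assms show ?thesis by (simp add: eq_fract)
  qed
  with assms show ?thesis
    unfolding rat_deriv_def by (intro the_equality) blast+
qed

lemma rat_deriv_const: "rat_deriv (const_rat a) = 0"
  by (simp add: rat_deriv_Fract fract_collapse pderiv_pCons)

lemma rat_deriv_X: "rat_deriv (Fraction_Field.Fract [:0, 1:] 1) = 1"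
  by (simp add: rat_deriv_Fract pderiv_pCons One_fract_def one_pCons)

lemma rat_deriv_add: "rat_deriv (f + g) = rat_deriv f + rat_deriv g"
proof (cases f; cases g)
  fix p q r s :: "'a poly"
  assume "f = Fraction_Field.Fract p q" "q \<noteq> 0" "g = Fraction_Field.Fract r s" "s \<noteq> 0"
  then show ?thesis
    by (simp add: rat_deriv_Fract eq_fract pderiv_mult pderiv_add algebra_simps)
qed

lemma rat_deriv_mult: "rat_deriv (f * g) = rat_deriv f * g + f * rat_deriv g"
proof (cases f; cases g)
  fix p q r s :: "'a poly"
  assume "f = Fraction_Field.Fract p q" "q \<noteq> 0" "g = Fraction_Field.Fract r s" "s \<noteq> 0"
  then show ?thesis
    by (simp add: rat_deriv_Fract eq_fract pderiv_mult algebra_simps)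
qed

text \<open>\<open>ring.eval\<close> expects the list of coefficients with the leading one first.\<close>

definition poly_value :: "'e ring \<Rightarrow> ('c::field \<Rightarrow> 'e) \<Rightarrow> 'c poly \<Rightarrow> 'e \<Rightarrow> 'e" where
  "poly_value E \<iota> p y = ring.eval E (map \<iota> (rev (Polynomial.coeffs p))) y"

text \<open>\<open>R\<close> is defined at \<open>y\<close>, i.e. has a representation whose denominator does not
  vanish at \<open>y\<close>, and \<open>R(y) = v\<close>; the value is independent of the representation.\<close>

definition rat_value ::
    "'e ring \<Rightarrow> ('c::field \<Rightarrow> 'e) \<Rightarrow> 'c poly fract \<Rightarrow> 'e \<Rightarrow> 'e \<Rightarrow> bool" where
  "rat_value E \<iota> R y v \<longleftrightarrow>
     (\<exists>p q. R = Fraction_Field.Fract p q \<and> q \<noteq> 0 \<and> poly_value E \<iota> q y \<noteq> \<zero>\<^bsub>E\<^esub> \<and>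
            v = poly_value E \<iota> p y \<otimes>\<^bsub>E\<^esub> inv\<^bsub>E\<^esub> (poly_value E \<iota> q y))"

text \<open>\<open>Y' = R(Y)\<close> has a non constant solution liouvillian over the type \<open>'c\<close> with the
  trivial derivation. HOL cannot quantify over all types inside a formula, so the
  extension is sought among the fields whose elements have type \<open>'e\<close>, and statements
  should be made for all sufficiently large \<open>'e\<close>.  If \<open>'c\<close> is infinite, "large" means that
  \<open>'c\<close> injects into \<open>'e\<close>: a finitely generated extension of \<open>'c\<close> has the cardinality of
  \<open>'c\<close>, hence an isomorphic copy with elements in \<open>'e\<close>, and conversely no extension of
  \<open>'c\<close> lives in a type into which \<open>'c\<close> does not inject.\<close>

definition has_nonconstant_liouvillian_solution ::
    "'e itself \<Rightarrow> 'c::field poly fract \<Rightarrow> bool" where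
  "has_nonconstant_liouvillian_solution _ R \<longleftrightarrow>
     (\<exists>(E :: 'e ring) (D :: 'e \<Rightarrow> 'e) (\<iota> :: 'c \<Rightarrow> 'e) (y :: 'e).
        liouvillian_extension (ring_of_type_algebra :: 'c ring) (\<lambda>_. 0) E D \<iota> \<and>
        y \<in> carrier E \<and> rat_value E \<iota> R y (D y) \<and> D y \<noteq> \<zero>\<^bsub>E\<^esub>)"

end

theory Submission
  imports Defs
begin

text \<open>
  Sufficiency is a direct construction. With \<open>D = R d/dX\<close> the field \<open>C(X)\<close> contains the solution
  \<open>y = X\<close>, and the given \<open>z\<close> satisfies \<open>D z = 1\<close> or \<open>D z = a z\<close>; as \<open>z\<close> is not a constant, \<open>X\<close> is
  algebraic over \<open>C(z)\<close>, so \<open>C \<subseteq> C(z) \<subseteq> C(X)\<close> is a liouvillian tower.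

  For necessity, let \<open>y\<close> be a non constant solution in a liouvillian extension \<open>E\<close>.

  \<^item> The tower is first enlarged by putting at its bottom the field of all constants of \<open>E\<close> in place
    of \<open>C\<close>. An element that is algebraic over constants is constant, so there is a first step
    \<open>k \<subseteq> k(t)\<close> of the enlarged tower at which \<open>y\<close> becomes algebraic. There \<open>t\<close> is transcendental
    over \<open>k\<close>, hence \<open>t' \<in> k\<close> or \<open>t'/t \<in> k\<close>, and by exchange \<open>t\<close> is algebraic over \<open>k(y)\<close>.
    Differentiating the minimal polynomial of \<open>t\<close> over \<open>k(y)\<close> gives a coefficient \<open>s \<in> k(y) - k\<close>
    with \<open>s' \<in> k\<close> or \<open>s'/s \<in> k\<close> (\<open>transcendental_generator_descends\<close>).

  \<^item> Let \<open>\<partial>\<close> be the \<open>k\<close>-linear derivation of \<open>k(y)\<close> with \<open>\<partial>y = 1\<close>. The derivation \<open>y'\<partial>\<close> commutes with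
    the given one, because the coefficients of \<open>R\<close> are constants. Therefore \<open>f = y'\<partial>s\<close>,
    respectively \<open>f = y'\<partial>s/s\<close>, has derivative zero. All constants lie in \<open>k\<close>, so \<open>f \<in> k\<close>, and as \<open>y\<close> is
    transcendental over \<open>k\<close> the relation \<open>R(y) \<partial>s = f\<close>, respectively \<open>R(y) \<partial>s = f s\<close>, is an identity
    of rational functions over \<open>k\<close> (\<open>first_integral\<close>).

  \<^item> It remains to replace \<open>s = A/B\<close> by an element of \<open>C(X)\<close>. With \<open>A\<close> and \<open>B\<close> coprime, the identity
    forces every root of \<open>B\<close> (and of \<open>A\<close> in the exponential case) to be a zero of the numerator of \<open>R\<close>. These
    zeros are in \<open>C\<close>, which is algebraically closed, so that \<open>B\<close> (and \<open>A\<close>) comes from \<open>C[X]\<close>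
    up to a factor (\<open>descend_of_dvd_pderiv\<close>). In the exponential case this is enough; in the primitive
    case a \<open>C\<close>-linear retraction onto \<open>C\<close> is applied to the coefficients of \<open>A\<close>.

  Most of this argument is about polynomials over fields, and it is carried out for fields that are
  types. To reach an extension \<open>E\<close> given by a carrier, a type is defined whose elements form a copy of
  a counterexample, if there is one; see \<open>test_field_axioms\<close>.
\<close>

section \<open>Descent of rational functions to an algebraically closed subfield\<close>

locale field_embedding =
  fixes emb :: "'c::field \<Rightarrow> 'f::field"
  assumes emb_add: "emb (x + y) = emb x + emb y"
    and emb_mult: "emb (x * y) = emb x * emb y"
    and emb_one [simp]: "emb 1 = 1"
begin

lemma emb_zero [simp]: "emb 0 = 0"
  using emb_add[of 0 0] by (metis add_cancel_right_right add.right_neutral)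

lemma emb_diff: "emb (x - y) = emb x - emb y"
  using emb_add[of "x - y" y] by (simp add: algebra_simps)

lemma emb_minus: "emb (- x) = - emb x"
  using emb_diff[of 0 x] by simp

lemma emb_eq_0_iff [simp]: "emb x = 0 \<longleftrightarrow> x = 0"
  using emb_mult[of x "inverse x"] by (cases "x = 0") auto

lemma emb_eq_iff [simp]: "emb x = emb y \<longleftrightarrow> x = y"
  using emb_diff[of x y] by auto

lemma emb_of_nat: "emb (of_nat n) = of_nat n"
  by (induction n) (simp_all add: emb_add)

lemma emb_sum: "emb (sum g A) = (\<Sum>x\<in>A. emb (g x))"
  by (induction A rule: infinite_finite_induct) (simp_all add: emb_add)

abbreviation lift_poly :: "'c poly \<Rightarrow> 'f poly" where
  "lift_poly \<equiv> map_poly emb"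

lemma coeff_lift_poly [simp]: "Polynomial.coeff (lift_poly p) i = emb (Polynomial.coeff p i)"
  by (simp add: coeff_map_poly)

lemma lift_poly_mult: "lift_poly (p * q) = lift_poly p * lift_poly q"
  by (intro poly_eqI) (simp add: coeff_mult emb_sum emb_mult)

lemma lift_poly_diff: "lift_poly (p - q) = lift_poly p - lift_poly q"
  by (intro poly_eqI) (simp add: emb_diff)

lemma lift_poly_smult: "lift_poly (Polynomial.smult c p) = Polynomial.smult (emb c) (lift_poly p)"
  by (intro poly_eqI) (simp add: emb_mult)

lemma lift_poly_pderiv: "lift_poly (pderiv p) = pderiv (lift_poly p)"
  by (intro poly_eqI) (simp add: coeff_pderiv emb_mult emb_add emb_of_nat)

lemma lift_poly_eq_0_iff [simp]: "lift_poly p = 0 \<longleftrightarrow> p = 0"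
  by (auto simp: poly_eq_iff)

lemma lift_poly_inject: "lift_poly p = lift_poly q \<longleftrightarrow> p = q"
  by (auto simp: poly_eq_iff)

lemma lift_poly_linear [simp]: "lift_poly [:- c, 1:] = [:- emb c, 1:]"
  by (simp add: map_poly_pCons emb_minus)

text \<open>
  The larger field is a vector space over the smaller one in which \<open>1\<close> is independent, so the
  functional that is \<open>1\<close> at \<open>1\<close> extends to it.
\<close>

lemma linear_retraction_exists:
  obtains l :: "'f \<Rightarrow> 'c" where "\<And>x y. l (x + y) = l x + l y" "\<And>c x. l (emb c * x) = c * l x" "l 1 = 1"
proof -
  interpret V: vector_space "\<lambda>c (x::'f). emb c * x"
    by unfold_locales (simp_all add: algebra_simps emb_add emb_mult)
  interpret W: vector_space "\<lambda>c (x::'c). c * x"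
    by unfold_locales (simp_all add: algebra_simps)
  interpret VW: vector_space_pair "\<lambda>c (x::'f). emb c * x" "\<lambda>c (x::'c). c * x" ..
  have "V.independent {1}"
    by (simp add: V.dependent_single)
  then obtain l where l: "Vector_Spaces.linear (\<lambda>c (x::'f). emb c * x) (\<lambda>c (x::'c). c * x) l"
      "\<forall>x\<in>{1}. l x = 1"
    using VW.linear_independent_extend[of "{1}" "\<lambda>_. 1"] by blast
  interpret l: Vector_Spaces.linear "\<lambda>c (x::'f). emb c * x" "\<lambda>c (x::'c). c * x" l by (fact l(1))
  show thesis
    by (rule that[of l]) (use l(2) l.add l.scale in auto)
qed

end

locale alg_closed_embedding = field_embedding emb
  for emb :: "'c::{alg_closed_field,field_char_0} \<Rightarrow> 'f::{field_char_0,field_gcd}"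
begin

text \<open>
  Over an algebraically closed field \<open>P\<close> is a product of linear factors, and \<open>A\<close> is coprime to each of
  them because it does not vanish at their roots.
\<close>

lemma dvd_cancel_lift:
  assumes "\<And>c. poly A (emb c) \<noteq> 0" "P \<noteq> 0" "A dvd q * lift_poly P"
  shows "A dvd q"
  using assms(2,3)
proof (induction "Polynomial.degree P" arbitrary: P q)
  case 0
  then obtain a where "P = [:a:]" by (metis degree_eq_zeroE)
  with 0 have "a \<noteq> 0" "A dvd Polynomial.smult (emb a) q" by (auto simp: map_poly_pCons)
  then show ?case by (simp add: dvd_smult_iff)
next
  case (Suc n)
  then obtain c where "poly P c = 0"
    using alg_closed_imp_poly_has_root[of P] by auto
  then obtain P1 where P: "P = [:- c, 1:] * P1" by (metis poly_eq_0_iff_dvd dvdE)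
  with Suc.prems(1) Suc.hyps(2) have P1: "P1 \<noteq> 0" "n = Polynomial.degree P1"
    by (auto simp: degree_mult_eq simp del: mult_pCons_left)
  from Suc.prems(2) have "A dvd (q * [:- emb c, 1:]) * lift_poly P1"
    unfolding P lift_poly_mult lift_poly_linear by (simp only: mult.assoc)
  then have "A dvd q * [:- emb c, 1:]"
    using Suc.hyps(1)[OF P1(2)] P1(1) by blast
  then obtain h where h: "q * [:- emb c, 1:] = A * h" by (elim dvdE)
  from arg_cong[OF this, of "\<lambda>p. poly p (emb c)"] have "poly h (emb c) = 0"
    using assms(1)[of c] by simp
  then obtain h1 where "h = [:- emb c, 1:] * h1" by (metis poly_eq_0_iff_dvd dvdE)
  with h have "q * [:- emb c, 1:] = (A * h1) * [:- emb c, 1:]" by (simp only: mult_ac)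
  then have "q = A * h1" by (subst (asm) mult_right_cancel) auto
  then show ?case by simp
qed

text \<open>
  A root of \<open>A\<close> of multiplicity \<open>m\<close> is a root of its derivative of multiplicity \<open>m - 1\<close> only, so the
  hypothesis forces it to be a root of \<open>P\<close>, hence an element of the small field. The induction
  removes such roots one at a time, moving the linear factor over to \<open>P\<close>. Once no root in the small
  field is left, \<open>A\<close> divides its own derivative and is a constant.
\<close>

lemma descend_of_dvd_pderiv:
  assumes "P \<noteq> 0" "A \<noteq> 0" "A dvd pderiv A * lift_poly P"
  shows "\<exists>e A0. e \<noteq> 0 \<and> A = Polynomial.smult e (lift_poly A0)"
  using assms
proof (induction "Polynomial.degree A" arbitrary: A P)
  case 0
  then obtain a where "A = [:a:]" by (metis degree_eq_zeroE)
  with 0 have "a \<noteq> 0" "A = Polynomial.smult a (lift_poly 1)" by (auto simp: one_pCons map_poly_pCons)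
  then show ?case by blast
next
  case (Suc n)
  show ?case
  proof (cases "\<exists>c. poly A (emb c) = 0")
    case False
    then have "A dvd pderiv A"
      using dvd_cancel_lift Suc.prems by blast
    then show ?thesis using Suc.hyps(2) by simp
  next
    case True
    then obtain c A1 where A: "A = [:- emb c, 1:] * A1" by (metis poly_eq_0_iff_dvd dvdE)
    have A1: "A1 \<noteq> 0" "n = Polynomial.degree A1"
      using A Suc.prems Suc.hyps(2) by (auto simp: degree_mult_eq simp del: mult_pCons_left)
    have "pderiv A = [:- emb c, 1:] * pderiv A1 + A1"
      unfolding A pderiv_mult by (simp add: pderiv_pCons)
    then have "A1 dvd ([:- emb c, 1:] * pderiv A1 + A1) * lift_poly P"
      using Suc.prems(3) A by (metis dvd_mult_right)
    then have "A1 dvd pderiv A1 * ([:- emb c, 1:] * lift_poly P) + A1 * lift_poly P"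
      by (simp only: ring_distribs mult_ac)
    then have "A1 dvd pderiv A1 * lift_poly ([:- c, 1:] * P)"
      unfolding lift_poly_mult lift_poly_linear by (simp add: dvd_add_left_iff)
    moreover have "[:- c, 1:] * P \<noteq> 0" using Suc.prems by (simp del: mult_pCons_left)
    ultimately obtain e A0 where "e \<noteq> 0" "A1 = Polynomial.smult e (lift_poly A0)"
      using Suc.hyps(1)[OF A1(2)] A1(1) by blast
    moreover from this have "A = Polynomial.smult e (lift_poly ([:- c, 1:] * A0))"
      unfolding A lift_poly_mult lift_poly_linear by (simp only: mult_smult_right)
    ultimately show ?thesis by blast
  qed
qed

lemma descend_scalar:
  assumes "lift_poly p = Polynomial.smult f (lift_poly q)" "q \<noteq> 0"
  obtains a where "f = emb a" "p = Polynomial.smult a q"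
proof -
  have "emb (Polynomial.coeff p (Polynomial.degree q)) = f * emb (lead_coeff q)"
    using arg_cong[OF assms(1), of "\<lambda>p. Polynomial.coeff p (Polynomial.degree q)"] by simp
  moreover have "Polynomial.lead_coeff q \<noteq> 0" using assms(2) by simp
  ultimately have "f = emb (Polynomial.coeff p (Polynomial.degree q) / Polynomial.lead_coeff q)"
    by (metis emb_eq_0_iff emb_mult nonzero_divide_eq_eq nonzero_eq_divide_eq mult.commute)
  then obtain a where "f = emb a" by blast
  with assms(1) have "lift_poly p = lift_poly (Polynomial.smult a q)" by (simp add: lift_poly_smult)
  with that \<open>f = emb a\<close> show thesis by (simp add: lift_poly_inject)
qed

end

lemma coprime_fraction:
  fixes A B :: "'f::field_gcd poly"
  assumes "B \<noteq> 0"
  obtains A1 B1 g where "A = g * A1" "B = g * B1" "coprime A1 B1" "g \<noteq> 0" "B1 \<noteq> 0"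
proof -
  have "\<exists>A1 B1 g. A = g * A1 \<and> B = g * B1 \<and> coprime A1 B1 \<and> g \<noteq> 0"
    using assms by (metis gcd_coprime_exists gcd_eq_0_iff mult.commute)
  with assms that show thesis by auto
qed

lemma wronskian_common_factor:
  fixes g :: "'f::field poly"
  shows "pderiv (g * A) * (g * B) - (g * A) * pderiv (g * B) = g * g * (pderiv A * B - A * pderiv B)"
  by (simp add: pderiv_mult algebra_simps)

text \<open>
  The numerator of the derivative of \<open>A/B\<close> vanishes only if \<open>A/B\<close> is a scalar: after cancelling the
  common factor, \<open>B\<close> divides its own derivative and is constant, and then so is \<open>A\<close>.
\<close>

lemma wronskian_eq_0:
  fixes A B :: "'f::{field_char_0,field_gcd} poly"
  assumes "B \<noteq> 0" "pderiv A * B - A * pderiv B = 0"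
  obtains c where "A = Polynomial.smult c B"
proof -
  obtain A1 B1 g where g: "A = g * A1" "B = g * B1" "coprime A1 B1" "g \<noteq> 0" "B1 \<noteq> 0"
    using coprime_fraction[OF assms(1)] .
  then have eq: "pderiv A1 * B1 = A1 * pderiv B1"
    using assms(2) wronskian_common_factor[of g A1 B1] by auto
  then have "B1 dvd A1 * pderiv B1" by (metis dvd_triv_right)
  then have "B1 dvd pderiv B1" using g(3) coprime_dvd_mult_right_iff[of B1 A1] coprime_commute by blast
  then have "Polynomial.degree B1 = 0" by simp
  then obtain b where b: "B1 = [:b:]" by (metis degree_eq_zeroE)
  with eq g have "pderiv A1 = 0" by auto
  then obtain a where a: "A1 = [:a:]" using pderiv_iszero by blast
  have "A = Polynomial.smult (a / b) B" using a b g by simp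
  with that show thesis .
qed

context alg_closed_embedding
begin

text \<open>
  The hypothesis says \<open>R z' = f z\<close> for \<open>z = A/B\<close> over the large field, where \<open>R = P/Q\<close>. Dividing by the
  common factor of \<open>A\<close> and \<open>B\<close> keeps the equation. Then \<open>A\<close> divides \<open>A' P\<close> and \<open>B\<close> divides \<open>B' P\<close>, so both
  are defined over the small field up to scalars, and comparing coefficients puts \<open>f\<close> there too.
\<close>

theorem descend_exponential:
  assumes "P \<noteq> 0" "Q \<noteq> 0" "A \<noteq> 0" "B \<noteq> 0" "f \<noteq> 0"
    and eq: "lift_poly P * (pderiv A * B - A * pderiv B) = Polynomial.smult f (lift_poly Q * (A * B))"
  shows "\<exists>z a. a \<noteq> 0 \<and> z \<noteq> 0 \<and> 1 / Fraction_Field.Fract P Q = 1 / (const_rat a * z) * rat_deriv z"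
proof -
  obtain A1 B1 g where g: "A = g * A1" "B = g * B1" "coprime A1 B1" "g \<noteq> 0" "B1 \<noteq> 0"
    using coprime_fraction[OF assms(4)] .
  have "A1 \<noteq> 0" using g assms by auto
  have "(g * g) * (lift_poly P * (pderiv A1 * B1 - A1 * pderiv B1))
      = (g * g) * Polynomial.smult f (lift_poly Q * (A1 * B1))"
    using eq unfolding g wronskian_common_factor by (simp add: mult_ac)
  then have eq1: "lift_poly P * (pderiv A1 * B1 - A1 * pderiv B1)
      = Polynomial.smult f (lift_poly Q * (A1 * B1))"
    using g(4) mult_left_cancel[of "g * g"] no_zero_divisors[of g g] by blast
  have "A1 dvd Polynomial.smult f (lift_poly Q * (A1 * B1))" "B1 dvd Polynomial.smult f (lift_poly Q * (A1 * B1))"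
    by (simp_all add: dvd_smult)
  then have "A1 dvd (pderiv A1 * lift_poly P) * B1 - A1 * (pderiv B1 * lift_poly P)"
     "B1 dvd (pderiv A1 * lift_poly P) * B1 - A1 * (pderiv B1 * lift_poly P)"
    unfolding eq1[symmetric] by (simp_all add: algebra_simps)
  then have "A1 dvd (pderiv A1 * lift_poly P) * B1" "B1 dvd A1 * (pderiv B1 * lift_poly P)"
    by (metis dvd_diff_right_iff dvd_diff_left_iff dvd_triv_left dvd_triv_right)+
  then have "A1 dvd pderiv A1 * lift_poly P" "B1 dvd pderiv B1 * lift_poly P"
    using g(3) coprime_dvd_mult_right_iff[of B1 A1] coprime_dvd_mult_left_iff[of A1 B1] coprime_commute by blast+
  then obtain e A0 e' B0 where e: "e \<noteq> 0" "A1 = Polynomial.smult e (lift_poly A0)"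
      "e' \<noteq> 0" "B1 = Polynomial.smult e' (lift_poly B0)"
    using descend_of_dvd_pderiv[OF assms(1)] \<open>A1 \<noteq> 0\<close> \<open>B1 \<noteq> 0\<close> by meson
  have "Polynomial.smult (e * e') (lift_poly (P * (pderiv A0 * B0 - A0 * pderiv B0)))
      = Polynomial.smult (e * e') (Polynomial.smult f (lift_poly (Q * (A0 * B0))))"
    using eq1 unfolding e by (simp add: lift_poly_mult lift_poly_diff lift_poly_pderiv pderiv_smult
      mult_ac smult_diff_right right_diff_distrib)
  then have "lift_poly (P * (pderiv A0 * B0 - A0 * pderiv B0)) = Polynomial.smult f (lift_poly (Q * (A0 * B0)))"
    using e by (metis mult_eq_0_iff smult_cancel)
  moreover have nz: "A0 \<noteq> 0" "B0 \<noteq> 0" using e \<open>A1 \<noteq> 0\<close> \<open>B1 \<noteq> 0\<close> by auto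
  ultimately obtain a where a: "f = emb a" "P * (pderiv A0 * B0 - A0 * pderiv B0) = Polynomial.smult a (Q * (A0 * B0))"
    using assms(2) descend_scalar by (metis no_zero_divisors)
  have "a \<noteq> 0" using a assms by auto
  then show ?thesis
    using nz assms a(2)
    by (intro exI[of _ "Fraction_Field.Fract A0 B0"] exI[of _ a])
       (auto simp: rat_deriv_Fract One_fract_def eq_fract Zero_fract_def mult_ac)
qed

text \<open>
  The hypothesis says \<open>R z' = f\<close> for \<open>z = A/B\<close> over the large field, where \<open>R = P/Q\<close>. As before \<open>B\<close> is
  defined over the small field up to a scalar. The equation is then linear in \<open>A/f\<close> with
  coefficients in the small field, so a linear retraction of the large field maps a solution to a
  solution.
\<close>

theorem descend_primitive:
  assumes "P \<noteq> 0" "Q \<noteq> 0" "B \<noteq> 0" "f \<noteq> 0"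
    and eq: "lift_poly P * (pderiv A * B - A * pderiv B) = Polynomial.smult f (lift_poly Q * (B * B))"
  shows "\<exists>z. 1 / Fraction_Field.Fract P Q = rat_deriv z"
proof -
  obtain A1 B1 g where g: "A = g * A1" "B = g * B1" "coprime A1 B1" "g \<noteq> 0" "B1 \<noteq> 0"
    using coprime_fraction[OF assms(3)] .
  have "(g * g) * (lift_poly P * (pderiv A1 * B1 - A1 * pderiv B1))
      = (g * g) * Polynomial.smult f (lift_poly Q * (B1 * B1))"
    using eq unfolding g wronskian_common_factor by (simp add: mult_ac)
  then have eq1: "lift_poly P * (pderiv A1 * B1 - A1 * pderiv B1)
      = Polynomial.smult f (lift_poly Q * (B1 * B1))"
    using g(4) mult_left_cancel[of "g * g"] no_zero_divisors[of g g] by blast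
  have "B1 dvd Polynomial.smult f (lift_poly Q * (B1 * B1))"
    by (simp add: dvd_smult)
  then have "B1 dvd (pderiv A1 * lift_poly P) * B1 - A1 * (pderiv B1 * lift_poly P)"
    unfolding eq1[symmetric] by (simp add: algebra_simps)
  then have "B1 dvd A1 * (pderiv B1 * lift_poly P)"
    by (metis dvd_diff_right_iff dvd_triv_right)
  then have "B1 dvd pderiv B1 * lift_poly P"
    using g(3) coprime_dvd_mult_right_iff[of B1 A1] coprime_commute by blast
  then obtain e B0 where e: "e \<noteq> 0" "B1 = Polynomial.smult e (lift_poly B0)"
    using descend_of_dvd_pderiv[OF assms(1)] \<open>B1 \<noteq> 0\<close> by meson
  \<comment> \<open>Absorbing the scalars in the numerator leaves an equation without \<open>f\<close>.\<close>
  define A2 where "A2 = Polynomial.smult (1 / (f * e)) A1"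
  have A1: "A1 = Polynomial.smult (f * e) A2" using e assms by (simp add: A2_def)
  have "Polynomial.smult (e * e * f) (lift_poly P * (pderiv A2 * lift_poly B0 - A2 * lift_poly (pderiv B0)))
      = Polynomial.smult (e * e * f) (lift_poly (Q * (B0 * B0)))"
    using eq1 unfolding e A1 by (simp add: lift_poly_mult lift_poly_pderiv pderiv_smult
      mult_ac smult_diff_right right_diff_distrib)
  then have "lift_poly P * (pderiv A2 * lift_poly B0 - A2 * lift_poly (pderiv B0)) = lift_poly (Q * (B0 * B0))"
    using e(1) assms(4) by (metis mult_eq_0_iff smult_cancel)
  then have eq2: "lift_poly (P * B0) * pderiv A2 - lift_poly (P * pderiv B0) * A2 = lift_poly (Q * (B0 * B0))"
    by (simp add: lift_poly_mult algebra_simps)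
  obtain l :: "'f \<Rightarrow> 'c" where l: "\<And>x y. l (x + y) = l x + l y" "\<And>c x. l (emb c * x) = c * l x" "l 1 = 1"
    using linear_retraction_exists by metis
  have l_emb: "l (emb c) = c" for c using l(2)[of c 1] l(3) by simp
  have l0 [simp]: "l 0 = 0" using l(2)[of 0 0] by simp
  have l_diff: "l (x - y) = l x - l y" for x y using l(1)[of "x - y" y] by simp
  have l_sum: "l (sum h S) = (\<Sum>x\<in>S. l (h x))" for h :: "nat \<Rightarrow> 'f" and S
    by (induction S rule: infinite_finite_induct) (simp_all add: l)
  have l_of_nat: "l (of_nat n * x) = of_nat n * l x" for n x
    using l(2)[of "of_nat n" x] by (simp add: emb_of_nat)
  have l_mult: "map_poly l (lift_poly U * S) = U * map_poly l S" for U S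
    by (intro poly_eqI) (simp add: coeff_mult coeff_map_poly l_sum l)
  have l_pderiv: "map_poly l (pderiv S) = pderiv (map_poly l S)" for S
    by (intro poly_eqI) (simp add: coeff_pderiv coeff_map_poly l_of_nat l(1) distrib_right
        flip: of_nat_Suc del: of_nat_Suc)
  have l_minus: "map_poly l (S - T) = map_poly l S - map_poly l T" for S T
    by (intro poly_eqI) (simp add: coeff_map_poly l_diff)
  have l_lift: "map_poly l (lift_poly U) = U" for U
    by (intro poly_eqI) (simp add: coeff_map_poly l_emb)
  have eq3: "P * B0 * pderiv (map_poly l A2) - P * pderiv B0 * map_poly l A2 = Q * (B0 * B0)"
    using arg_cong[OF eq2, of "map_poly l"] unfolding l_minus l_mult l_pderiv l_lift .
  have "B0 \<noteq> 0" using e \<open>B1 \<noteq> 0\<close> by auto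
  then show ?thesis
    using assms eq3
    by (intro exI[of _ "Fraction_Field.Fract (map_poly l A2) B0"])
       (simp add: rat_deriv_Fract One_fract_def eq_fract algebra_simps)
qed

end

section \<open>Subfields and algebraic elements of a field that is a type\<close>

abbreviation type_ring :: "'f::field ring" where
  "type_ring \<equiv> ring_of_type_algebra"

lemma carrier_type_ring [simp]: "carrier type_ring = UNIV"
  and zero_type_ring [simp]: "\<zero>\<^bsub>type_ring\<^esub> = 0"
  and one_type_ring [simp]: "\<one>\<^bsub>type_ring\<^esub> = 1"
  and add_type_ring [simp]: "x \<oplus>\<^bsub>type_ring\<^esub> y = x + y"
  and mult_type_ring [simp]: "x \<otimes>\<^bsub>type_ring\<^esub> y = x * y"
  by (simp_all add: ring_of_type_algebra_def)

lemma a_inv_type_ring [simp]: "\<ominus>\<^bsub>type_ring\<^esub> x = - (x :: 'f::field)"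
proof -
  interpret field "type_ring :: 'f ring" by (rule field_from_type_algebra)
  show ?thesis using minus_equality[of "- x" x] by simp
qed

lemma m_inv_type_ring [simp]: "x \<noteq> 0 \<Longrightarrow> inv\<^bsub>type_ring\<^esub> x = inverse (x :: 'f::field)"
proof -
  interpret field "type_ring :: 'f ring" by (rule field_from_type_algebra)
  assume "x \<noteq> 0"
  then show ?thesis using comm_inv_char[of x "inverse x"] by simp
qed

lemma nat_pow_type_ring [simp]: "x [^]\<^bsub>type_ring\<^esub> (n::nat) = (x :: 'f::field) ^ n"
proof -
  interpret field "type_ring :: 'f ring" by (rule field_from_type_algebra)
  show ?thesis by (induction n) (simp_all add: mult.commute)
qed

lemma subfield_type_ringD:
  fixes S :: "'f::field set"
  assumes "subfield S type_ring"
  shows "0 \<in> S" "1 \<in> S" "\<And>x y. x \<in> S \<Longrightarrow> y \<in> S \<Longrightarrow> x + y \<in> S" "\<And>x. x \<in> S \<Longrightarrow> - x \<in> S"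
    "\<And>x y. x \<in> S \<Longrightarrow> y \<in> S \<Longrightarrow> x - y \<in> S" "\<And>x y. x \<in> S \<Longrightarrow> y \<in> S \<Longrightarrow> x * y \<in> S"
    "\<And>x. x \<in> S \<Longrightarrow> inverse x \<in> S" "\<And>x y. x \<in> S \<Longrightarrow> y \<in> S \<Longrightarrow> x / y \<in> S"
proof -
  interpret field "type_ring :: 'f ring" by (rule field_from_type_algebra)
  note E = subringE[OF subfieldE(1)[OF assms]]
  show 1: "0 \<in> S" "1 \<in> S" and add: "\<And>x y. x \<in> S \<Longrightarrow> y \<in> S \<Longrightarrow> x + y \<in> S"
    and neg: "\<And>x. x \<in> S \<Longrightarrow> - x \<in> S" and mult: "\<And>x y. x \<in> S \<Longrightarrow> y \<in> S \<Longrightarrow> x * y \<in> S"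
    using E(2,3,5,6,7) by simp_all
  show inverse: "inverse x \<in> S" if "x \<in> S" for x
    using subfield_m_inv(1)[OF assms, of x] that 1 by (cases "x = 0") auto
  show "x - y \<in> S" if "x \<in> S" "y \<in> S" for x y
    using add[OF that(1) neg[OF that(2)]] by simp
  show "x / y \<in> S" if "x \<in> S" "y \<in> S" for x y
    using mult[OF that(1) inverse[OF that(2)]] by (simp add: divide_inverse)
qed

lemma subfield_type_ringI:
  fixes S :: "'f::field set"
  assumes "1 \<in> S" "\<And>x y. x \<in> S \<Longrightarrow> y \<in> S \<Longrightarrow> x + y \<in> S" "\<And>x. x \<in> S \<Longrightarrow> - x \<in> S"
    "\<And>x y. x \<in> S \<Longrightarrow> y \<in> S \<Longrightarrow> x * y \<in> S" "\<And>x. x \<in> S \<Longrightarrow> x \<noteq> 0 \<Longrightarrow> inverse x \<in> S"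
  shows "subfield S type_ring"
proof -
  interpret field "type_ring :: 'f ring" by (rule field_from_type_algebra)
  show ?thesis using assms by (intro subfieldI' subringI) auto
qed

lemma (in field_embedding) subfield_range_emb: "subfield (range emb) type_ring"
proof (rule subfield_type_ringI)
  show "1 \<in> range emb" by (rule range_eqI[of _ _ 1]) simp
  fix x y assume "x \<in> range emb" "y \<in> range emb"
  then obtain b c where bc: "x = emb b" "y = emb c" by blast
  show "x + y \<in> range emb" by (rule range_eqI[of _ _ "b + c"]) (simp add: bc emb_add)
  show "x * y \<in> range emb" by (rule range_eqI[of _ _ "b * c"]) (simp add: bc emb_mult)
  show "- x \<in> range emb" by (rule range_eqI[of _ _ "- b"]) (simp add: bc emb_minus)
  assume "x \<noteq> 0"
  then have "emb b * emb (inverse b) = 1" by (simp add: bc flip: emb_mult)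
  then show "inverse x \<in> range emb" unfolding bc using inverse_unique by blast
qed

definition poly_over :: "'f::zero set \<Rightarrow> 'f poly \<Rightarrow> bool" where
  "poly_over S p \<longleftrightarrow> (\<forall>i. Polynomial.coeff p i \<in> S)"

lemma poly_overD: "poly_over S p \<Longrightarrow> Polynomial.coeff p i \<in> S"
  by (simp add: poly_over_def)

lemma poly_over_mono: "poly_over S p \<Longrightarrow> S \<subseteq> T \<Longrightarrow> poly_over T p"
  by (auto simp: poly_over_def)

context
  fixes S :: "'f::field set"
  assumes S: "subfield S type_ring"
begin

lemma subfield_sum: "(\<And>x. x \<in> A \<Longrightarrow> g x \<in> S) \<Longrightarrow> sum g A \<in> S"
  by (induction A rule: infinite_finite_induct) (auto simp: subfield_type_ringD[OF S])

lemma subfield_power: "x \<in> S \<Longrightarrow> x ^ n \<in> S"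
  by (induction n) (auto simp: subfield_type_ringD[OF S])

lemma subfield_of_nat: "of_nat n \<in> S"
  by (induction n) (auto simp: subfield_type_ringD[OF S])

lemma poly_over_add: "poly_over S p \<Longrightarrow> poly_over S q \<Longrightarrow> poly_over S (p + q)"
  and poly_over_diff: "poly_over S p \<Longrightarrow> poly_over S q \<Longrightarrow> poly_over S (p - q)"
  and poly_over_uminus: "poly_over S p \<Longrightarrow> poly_over S (- p)"
  and poly_over_smult: "c \<in> S \<Longrightarrow> poly_over S p \<Longrightarrow> poly_over S (Polynomial.smult c p)"
  and poly_over_const: "c \<in> S \<Longrightarrow> poly_over S [:c:]"
  and poly_over_pCons: "c \<in> S \<Longrightarrow> poly_over S p \<Longrightarrow> poly_over S (pCons c p)"
  and poly_over_0: "poly_over S 0"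
  and poly_over_1: "poly_over S 1"
  by (auto simp: poly_over_def subfield_type_ringD[OF S] coeff_pCons split: nat.split)

lemma poly_over_mult: "poly_over S p \<Longrightarrow> poly_over S q \<Longrightarrow> poly_over S (p * q)"
  by (auto simp: poly_over_def coeff_mult intro!: subfield_sum subfield_type_ringD(6)[OF S])

lemma poly_over_pderiv: "poly_over S p \<Longrightarrow> poly_over S (pderiv p)"
  using subfield_of_nat
  by (auto simp: poly_over_def coeff_pderiv simp flip: of_nat_Suc intro!: subfield_type_ringD(6)[OF S])

lemma poly_in_subfield: "poly_over S p \<Longrightarrow> x \<in> S \<Longrightarrow> poly p x \<in> S"
  by (auto simp: poly_altdef poly_over_def intro!: subfield_sum subfield_type_ringD(6)[OF S] subfield_power)

end

lemma eval_type_ring: "ring.eval type_ring cs x = poly (Poly (rev cs)) (x :: 'f::field)"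
proof -
  interpret field "type_ring :: 'f ring" by (rule field_from_type_algebra)
  show ?thesis
  proof (induction cs)
    case (Cons a cs)
    then show ?case
      by (simp add: Poly_append poly_monom add.commute)
  qed simp
qed

lemma poly_value_type_ring: "poly_value type_ring h p x = poly (map_poly h p) (x :: 'f::field)"
  by (simp add: poly_value_def eval_type_ring map_poly_def rev_map)

definition algebraic_over :: "'f::field set \<Rightarrow> 'f \<Rightarrow> bool" where
  "algebraic_over S x \<longleftrightarrow> (\<exists>p. p \<noteq> 0 \<and> poly_over S p \<and> poly p x = 0)"

lemma algebraic_type_ring_iff:
  fixes S :: "'f::field set"
  assumes S: "subfield S type_ring"
  shows "(ring.algebraic type_ring over S) x \<longleftrightarrow> algebraic_over S x"
proof -
  interpret field "type_ring :: 'f ring" by (rule field_from_type_algebra)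
  show ?thesis
  proof
    assume "(algebraic over S) x"
    then obtain cs where cs: "cs \<in> carrier (S[X]\<^bsub>type_ring\<^esub>)" "cs \<noteq> []" "eval cs x = \<zero>\<^bsub>type_ring\<^esub>"
      using algebraicE[OF subfieldE(1)[OF S]] by auto
    then have "set cs \<subseteq> S" "hd cs \<noteq> 0"
      by (auto simp: univ_poly_carrier[symmetric] polynomial_def)
    have "Polynomial.coeff (Poly (rev cs)) (length cs - 1) = hd cs"
      using cs(2) by (simp add: nth_default_def rev_nth hd_conv_nth)
    then have "Poly (rev cs) \<noteq> 0"
      using \<open>hd cs \<noteq> 0\<close> by (metis coeff_0)
    moreover have "poly_over S (Poly (rev cs))"
      using \<open>set cs \<subseteq> S\<close> subfield_type_ringD(1)[OF S]
      by (simp add: poly_over_def nth_default_def) (metis length_rev nth_mem set_rev subsetD)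
    ultimately show "algebraic_over S x"
      using cs(3) by (auto simp: algebraic_over_def eval_type_ring)
  next
    assume "algebraic_over S x"
    then obtain p where p: "p \<noteq> 0" "poly_over S p" "poly p x = 0" by (auto simp: algebraic_over_def)
    let ?cs = "rev (Polynomial.coeffs p)"
    have "set ?cs \<subseteq> S"
      using p(2) by (auto simp: poly_over_def coeffs_def)
    moreover have "hd ?cs \<noteq> 0" using p(1) by (simp add: hd_rev last_coeffs_eq_coeff_degree)
    ultimately have "?cs \<in> carrier (S[X]\<^bsub>type_ring\<^esub>)"
      by (simp add: univ_poly_carrier[symmetric] polynomial_def)
    then show "(algebraic over S) x"
      using p by (intro algebraicI[of ?cs]) (auto simp: eval_type_ring)
  qed
qed

text \<open>
  The quotients on the right form a subfield, which contains \<open>t\<close> and \<open>k\<close>.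
\<close>

lemma generate_field_insert:
  fixes k :: "'f::field set"
  assumes k: "subfield k type_ring"
  shows "generate_field type_ring (insert t k) =
    {poly p t / poly q t | p q. poly_over k p \<and> poly_over k q \<and> poly q t \<noteq> 0}" (is "_ = ?K")
proof -
  interpret field "type_ring :: 'f ring" by (rule field_from_type_algebra)
  note kD = subfield_type_ringD[OF k]
  have memI: "poly p t / poly q t \<in> ?K" if "poly_over k p" "poly_over k q" "poly q t \<noteq> 0" for p q
    using that by blast
  have K: "subfield ?K type_ring"
  proof (rule subfield_type_ringI)
    show "1 \<in> ?K" using memI[of 1 1] poly_over_1[OF k] by simp
  next
    fix x y assume "x \<in> ?K" "y \<in> ?K"
    then obtain p q r s where xy: "x = poly p t / poly q t" "y = poly r t / poly s t"
      "poly_over k p" "poly_over k q" "poly_over k r" "poly_over k s" "poly q t \<noteq> 0" "poly s t \<noteq> 0"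
      by blast
    have "x + y = poly (p * s + r * q) t / poly (q * s) t" "x * y = poly (p * r) t / poly (q * s) t"
      unfolding xy(1,2) using xy(7,8) by (simp_all add: field_simps)
    then show "x + y \<in> ?K" "x * y \<in> ?K"
      using memI[of "p * s + r * q" "q * s"] memI[of "p * r" "q * s"] xy poly_over_add[OF k] poly_over_mult[OF k]
      by auto
  next
    fix x assume "x \<in> ?K"
    then obtain p q where x: "x = poly p t / poly q t" "poly_over k p" "poly_over k q" "poly q t \<noteq> 0"
      by blast
    show "- x \<in> ?K" using memI[of "- p" q] x poly_over_uminus[OF k] by simp
    show "inverse x \<in> ?K" if "x \<noteq> 0" using memI[of q p] x that by simp
  qed
  have "insert t k \<subseteq> ?K"
  proof
    fix x assume "x \<in> insert t k"
    then have "poly_over k (if x \<in> k then [:x:] else [:0, 1:])" "x = t \<or> x \<in> k"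
      using kD by (auto simp: poly_over_pCons[OF k] poly_over_const[OF k])
    then show "x \<in> ?K"
      using memI[of "if x \<in> k then [:x:] else [:0, 1:]" 1] poly_over_1[OF k] by (auto split: if_splits)
  qed
  then have "generate_field type_ring (insert t k) \<subseteq> ?K"
    by (intro generate_field_min_subfield1[OF _ K]) simp_all
  moreover have "?K \<subseteq> generate_field type_ring (insert t k)" (is "_ \<subseteq> ?L")
  proof
    have L: "subfield ?L type_ring" by (rule generate_field_is_subfield) simp
    fix x assume "x \<in> ?K"
    then obtain p q where x: "x = poly p t / poly q t" "poly_over k p" "poly_over k q" "poly q t \<noteq> 0"
      by blast
    have "k \<subseteq> ?L" "t \<in> ?L" by (auto intro: generate_field.incl)
    then have "poly p t \<in> ?L" "poly q t \<in> ?L"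
      using x by (auto intro!: poly_in_subfield[OF L] elim: poly_over_mono)
    then show "x \<in> ?L" using x(1) subfield_type_ringD(8)[OF L] by simp
  qed
  ultimately show ?thesis by blast
qed

lemma subfield_generate: "subfield (generate_field type_ring H) (type_ring :: 'f::field ring)"
proof -
  interpret field "type_ring :: 'f ring" by (rule field_from_type_algebra)
  show ?thesis by (rule generate_field_is_subfield) simp
qed

lemma algebraic_over_mono: "algebraic_over S x \<Longrightarrow> S \<subseteq> T \<Longrightarrow> algebraic_over T x"
  by (auto simp: algebraic_over_def intro: poly_over_mono)

lemma algebraic_over_self: "subfield k type_ring \<Longrightarrow> x \<in> k \<Longrightarrow> algebraic_over k x"
  by (auto simp: algebraic_over_def subfield_type_ringD poly_over_pCons poly_over_const
      intro!: exI[of _ "[:- x, 1:]"])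

text \<open>
  Both steps of the tower \<open>k \<subseteq> k(t) \<subseteq> k(t, y)\<close> have finite dimension, so \<open>k(t, y)\<close> has finite dimension
  over \<open>k\<close>.
\<close>

lemma algebraic_over_trans:
  fixes k :: "'f::field set"
  assumes k: "subfield k type_ring" and t: "algebraic_over k t"
    and y: "algebraic_over (generate_field type_ring (insert t k)) y"
  shows "algebraic_over k y"
proof -
  interpret field "type_ring :: 'f ring" by (rule field_from_type_algebra)
  let ?L = "simple_extension k t"
  have t': "(algebraic over k) t" using t algebraic_type_ring_iff[OF k] by blast
  have L: "subfield ?L type_ring" using simple_extension_is_subfield[OF k, of t] t' by simp
  have "generate_field type_ring (insert t k) \<subseteq> ?L"
    using simple_extension_incl[of k t] simple_extension_mem[OF subfieldE(1)[OF k], of t]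
    by (intro generate_field_min_subfield1[OF _ L]) auto
  then have y': "(algebraic over ?L) y"
    using algebraic_over_mono[OF y] algebraic_type_ring_iff[OF L] by blast
  have "finite_dimension k ?L" "finite_dimension ?L (simple_extension ?L y)"
    using finite_dimension_simple_extension[OF k, of t] finite_dimension_simple_extension[OF L, of y] t' y'
    by simp_all
  then have "finite_dimension k (simple_extension ?L y)"
    using telescopic_base_dim(1)[OF k L] by blast
  moreover have "y \<in> simple_extension ?L y" "subring (simple_extension ?L y) type_ring"
    using simple_extension_mem[OF subfieldE(1)[OF L], of y] simple_extension_is_subring[OF subfieldE(1)[OF L], of y]
    by simp_all
  ultimately have "(algebraic over k) y"
    using finite_dimension_imp_algebraic[OF k] by blast
  then show ?thesis using algebraic_type_ring_iff[OF k] by blast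
qed

lemma common_denominator:
  fixes k :: "'f::field set"
  assumes k: "subfield k type_ring" and p: "poly_over (generate_field type_ring (insert t k)) p"
  shows "\<exists>v u. poly_over k v \<and> poly v t \<noteq> 0 \<and> (\<forall>i. poly_over k (u i) \<and> poly v t * Polynomial.coeff p i = poly (u i) t)"
  using p
proof (induction p)
  case 0
  show ?case by (intro exI[of _ 1] exI[of _ "\<lambda>_. 0"]) (simp add: poly_over_0[OF k] poly_over_1[OF k])
next
  case (pCons a p)
  have "a \<in> generate_field type_ring (insert t k)"
    using poly_overD[OF pCons.prems, of 0] by simp
  then obtain r s where a: "a = poly r t / poly s t" "poly_over k r" "poly_over k s" "poly s t \<noteq> 0"
    unfolding generate_field_insert[OF k] by blast
  have "poly_over (generate_field type_ring (insert t k)) p"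
    unfolding poly_over_def using poly_overD[OF pCons.prems, of "Suc _"] by simp
  then obtain v u where vu: "poly_over k v" "poly v t \<noteq> 0"
    "\<And>i. poly_over k (u i)" "\<And>i. poly v t * Polynomial.coeff p i = poly (u i) t"
    using pCons.IH by blast
  show ?case
    by (intro exI[of _ "v * s"] exI[of _ "\<lambda>i. case i of 0 \<Rightarrow> v * r | Suc j \<Rightarrow> u j * s"])
       (use vu a in \<open>auto simp: poly_over_mult[OF k] coeff_pCons field_simps split: nat.split\<close>)
qed

text \<open>
  Clearing denominators turns an equation of \<open>y\<close> over \<open>k(t)\<close> into a polynomial relation between \<open>y\<close>
  and \<open>t\<close>, which can be read as an equation of \<open>t\<close> over \<open>k(y)\<close>. It is not trivial, because each of its
  coefficients is a polynomial in \<open>y\<close>, and \<open>y\<close> is transcendental.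
\<close>

lemma algebraic_over_exchange:
  fixes k :: "'f::field set"
  assumes k: "subfield k type_ring" and y: "algebraic_over (generate_field type_ring (insert t k)) y"
    and ny: "\<not> algebraic_over k y"
  shows "algebraic_over (generate_field type_ring (insert y k)) t"
proof -
  let ?L = "generate_field type_ring (insert y k)"
  have L: "subfield ?L type_ring" by (rule subfield_generate)
  have kL: "k \<subseteq> ?L" "y \<in> ?L" by (auto intro: generate_field.incl)
  obtain p where p: "p \<noteq> 0" "poly_over (generate_field type_ring (insert t k)) p" "poly p y = 0"
    using y by (auto simp: algebraic_over_def)
  obtain v u where vu: "poly_over k v" "poly v t \<noteq> 0"
    "\<And>i. poly_over k (u i)" "\<And>i. poly v t * Polynomial.coeff p i = poly (u i) t"
    using common_denominator[OF k p(2)] by blast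
  define n where "n = Polynomial.degree p"
  define w where "w = (\<Sum>i\<le>n. Polynomial.smult (y ^ i) (u i))"
  have "poly w t = (\<Sum>i\<le>n. y ^ i * poly (u i) t)"
    by (simp add: w_def poly_sum)
  also have "\<dots> = poly v t * poly p y"
    unfolding vu(4)[symmetric] poly_altdef[of p] n_def by (simp add: sum_distrib_left mult_ac)
  finally have "poly w t = 0" using p(3) by simp
  moreover have "poly_over ?L w"
    unfolding poly_over_def w_def coeff_sum
    using vu(3) kL by (auto simp: poly_over_def intro!: subfield_sum[OF L] subfield_type_ringD(6)[OF L] subfield_power[OF L])
  moreover have "w \<noteq> 0"
  proof
    assume "w = 0"
    have "Polynomial.coeff p n \<noteq> 0" using p(1) by (simp add: n_def)
    then have "poly (u n) t \<noteq> 0" using vu(2) vu(4)[of n] by auto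
    then have "u n \<noteq> 0" by auto
    then obtain j where j: "Polynomial.coeff (u n) j \<noteq> 0" by (auto simp: poly_eq_iff)
    \<comment> \<open>The coefficient of \<open>w\<close> at \<open>j\<close>, as a polynomial in \<open>y\<close>.\<close>
    define g where "g = (\<Sum>i\<le>n. Polynomial.monom (Polynomial.coeff (u i) j) i)"
    have cg: "Polynomial.coeff g i = (if i \<le> n then Polynomial.coeff (u i) j else 0)" for i
      by (simp add: g_def coeff_sum if_distrib cong: if_cong)
    have "poly g y = Polynomial.coeff w j"
      by (simp add: g_def w_def poly_sum poly_monom coeff_sum mult_ac)
    then have "poly g y = 0" using \<open>w = 0\<close> by simp
    moreover have "g \<noteq> 0" using cg[of n] j by auto
    moreover have "poly_over k g"
      using vu(3) subfield_type_ringD(1)[OF k] by (auto simp: poly_over_def cg)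
    ultimately show False using ny by (auto simp: algebraic_over_def)
  qed
  ultimately show ?thesis by (auto simp: algebraic_over_def)
qed

section \<open>Derivations and the minimal polynomial of a generator\<close>

lemma minimal_polynomial_exists:
  fixes L :: "'f::field set"
  assumes L: "subfield L type_ring" and t: "algebraic_over L t"
  obtains m where "Polynomial.lead_coeff m = 1" "poly_over L m" "poly m t = 0"
    "\<And>q. poly_over L q \<Longrightarrow> poly q t = 0 \<Longrightarrow> Polynomial.degree q < Polynomial.degree m \<Longrightarrow> q = 0"
proof -
  let ?Q = "\<lambda>p. p \<noteq> 0 \<and> poly_over L p \<and> poly p t = 0"
  obtain p0 where "?Q p0" using t by (auto simp: algebraic_over_def)
  then obtain p where p: "?Q p" and min: "\<And>q. ?Q q \<Longrightarrow> Polynomial.degree p \<le> Polynomial.degree q"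
    using ex_has_least_nat[of ?Q p0 Polynomial.degree] by blast
  let ?m = "Polynomial.smult (inverse (Polynomial.lead_coeff p)) p"
  show thesis
  proof (rule that[of ?m])
    show "poly_over L ?m"
      using p subfield_type_ringD(7)[OF L poly_overD] poly_over_smult[OF L] by blast
    fix q assume "poly_over L q" "poly q t = 0" "Polynomial.degree q < Polynomial.degree ?m"
    with min[of q] show "q = 0" by (auto split: if_splits)
  qed (use p in simp_all)
qed

locale derivation =
  fixes D :: "'f::field \<Rightarrow> 'f"
  assumes D_add: "D (x + y) = D x + D y"
    and D_mult: "D (x * y) = D x * y + x * D y"
begin

lemma D_zero [simp]: "D 0 = 0"
  using D_add[of 0 0] by (metis add_cancel_right_right add.right_neutral)

lemma D_one [simp]: "D 1 = 0"
  using D_mult[of 1 1] by (metis add_cancel_right_right mult.left_neutral mult.right_neutral)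

lemma D_minus: "D (- x) = - D x"
  using D_add[of x "- x"] by (simp add: eq_neg_iff_add_eq_0 add.commute)

lemma D_inverse: "x \<noteq> 0 \<Longrightarrow> D (inverse x) = - D x * inverse x * inverse x"
  using D_mult[of x "inverse x"] by (simp add: field_simps eq_neg_iff_add_eq_0)

lemma D_divide: "y \<noteq> 0 \<Longrightarrow> D (x / y) = (D x * y - x * D y) / (y * y)"
proof -
  assume "y \<noteq> 0"
  then have "D (x * inverse y) = D x * inverse y - x * (D y * inverse y * inverse y)"
    by (simp add: D_mult D_inverse)
  then show ?thesis using \<open>y \<noteq> 0\<close> by (simp add: field_simps)
qed

lemma D_poly: "D (poly p x) = poly (map_poly D p) x + poly (pderiv p) x * D x"
  by (induction p) (simp_all add: D_add D_mult map_poly_pCons pderiv_pCons algebra_simps)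

lemma coeff_map_poly_D [simp]: "Polynomial.coeff (map_poly D p) i = D (Polynomial.coeff p i)"
  by (simp add: coeff_map_poly)

definition constants :: "'f set" where
  "constants = {x. D x = 0}"

lemma subfield_constants: "subfield constants type_ring"
  by (rule subfield_type_ringI) (simp_all add: constants_def D_add D_minus D_mult D_inverse)

lemma stable_generate_field:
  assumes H: "D ` H \<subseteq> generate_field type_ring H"
  shows "D ` generate_field type_ring H \<subseteq> generate_field type_ring H"
proof (rule image_subsetI)
  note L = subfield_type_ringD[OF subfield_generate[of H]]
  fix x assume "x \<in> generate_field type_ring H"
  then show "D x \<in> generate_field type_ring H"
  proof induction
    case (incl h)
    then show ?case using H by blast
  next
    case (eng_mult x y)
    then show ?case using L(3,6) by (simp add: D_mult)
  qed (use L in \<open>simp_all add: D_add D_minus D_inverse\<close>)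
qed

text \<open>
  Let \<open>m\<close> be the minimal polynomial of \<open>t\<close> over \<open>L\<close>, of degree \<open>d\<close>. Differentiating \<open>m(t) = 0\<close> gives a
  polynomial over \<open>L\<close> that vanishes at \<open>t\<close>. Both for \<open>t' = b\<close> and for \<open>t' = b t\<close> with \<open>b \<in> k\<close> it can be given
  degree less than \<open>d\<close>, in the second case by subtracting \<open>d b m\<close>. It is then zero, and this is a
  system of differential equations for the coefficients: \<open>m\<^sub>j' = - (j + 1) b m\<^sub>j\<^sub>+\<^sub>1\<close> in the first case
  and \<open>m\<^sub>j' = (d - j) b m\<^sub>j\<close> in the second one. Since \<open>t\<close> is transcendental over \<open>k\<close>, some
  coefficient lies outside \<open>k\<close>. In the first case the last such coefficient has the required
  property, in the second case any of them.
\<close>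

lemma transcendental_generator_descends:
  assumes k: "subfield k type_ring" "D ` k \<subseteq> k"
    and L: "subfield L type_ring" "D ` L \<subseteq> L" "k \<subseteq> L"
    and t: "algebraic_over L t" "\<not> algebraic_over k t"
    and gen: "D t \<in> k \<or> (t \<noteq> 0 \<and> D t / t \<in> k)"
  obtains s where "s \<in> L" "s \<notin> k" "D s \<in> k \<or> (s \<noteq> 0 \<and> D s / s \<in> k)"
proof -
  obtain m where m: "Polynomial.lead_coeff m = 1" "poly_over L m" "poly m t = 0"
    and min: "\<And>q. poly_over L q \<Longrightarrow> poly q t = 0 \<Longrightarrow> Polynomial.degree q < Polynomial.degree m \<Longrightarrow> q = 0"
    using minimal_polynomial_exists[OF L(1) t(1)] by metis
  define d where "d = Polynomial.degree m"
  have m0: "m \<noteq> 0" using m(1) by auto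
  have md: "Polynomial.coeff m d = 1" using m(1) by (simp add: d_def)
  have "\<not> poly_over k m"
    using t(2) m m0 by (auto simp: algebraic_over_def)
  then obtain i where i: "Polynomial.coeff m i \<notin> k" by (auto simp: poly_over_def)
  note kD = subfield_type_ringD[OF k(1)]
  have le_d: "j < d" if "Polynomial.coeff m j \<notin> k" for j
  proof (rule ccontr)
    assume "\<not> j < d"
    then have "Polynomial.coeff m j \<in> {0, 1}"
      using md coeff_eq_0[of m j] by (cases "j = d") (auto simp: d_def)
    then show False using that kD by auto
  qed
  have Dm: "poly_over L (map_poly D m)" "poly_over L (pderiv m)"
    using m(2) L(2) poly_over_pderiv[OF L(1)] by (auto simp: poly_over_def)
  have d_pos: "d \<noteq> 0" using le_d[OF i] by simp
  have deg0: "q = 0" if "poly_over L q" "poly q t = 0" "\<And>j. d \<le> j \<Longrightarrow> Polynomial.coeff q j = 0" for q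
  proof -
    have "Polynomial.degree q \<le> d - 1"
      by (rule degree_le) (use that(3) in auto)
    then show ?thesis using min[OF that(1,2)] d_pos by (simp add: d_def)
  qed
  have high: "Polynomial.coeff m j = 0" if "d < j" for j
    using that by (simp add: d_def coeff_eq_0)
  have Dmt: "poly (map_poly D m) t + poly (pderiv m) t * D t = 0"
    using D_poly[of m t] m(3) by simp
  show thesis
  proof (cases "D t \<in> k")
    case True
    define q where "q = map_poly D m + Polynomial.smult (D t) (pderiv m)"
    have "q = 0"
    proof (rule deg0)
      show "poly_over L q"
        unfolding q_def using Dm True L(3) by (auto intro!: poly_over_add[OF L(1)] poly_over_smult[OF L(1)])
      show "poly q t = 0" using Dmt by (simp add: q_def mult.commute)
      fix j assume "d \<le> j"
      then show "Polynomial.coeff q j = 0"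
        using md high by (cases "j = d") (simp_all add: q_def coeff_pderiv)
    qed
    obtain j where j: "Polynomial.coeff m j \<notin> k" "\<And>j'. Polynomial.coeff m j' \<notin> k \<Longrightarrow> j' \<le> j"
      using ex_has_greatest_nat[of "\<lambda>j. Polynomial.coeff m j \<notin> k" i "\<lambda>j. j" d] i le_d less_imp_le by blast
    have "Polynomial.coeff m (Suc j) \<in> k" using j(2)[of "Suc j"] by auto
    moreover have "D (Polynomial.coeff m j) = - (D t * (of_nat (Suc j) * Polynomial.coeff m (Suc j)))"
      using arg_cong[OF \<open>q = 0\<close>, of "\<lambda>q. Polynomial.coeff q j"]
      by (simp add: q_def coeff_pderiv eq_neg_iff_add_eq_0)
    ultimately have "D (Polynomial.coeff m j) \<in> k"
      using kD True subfield_of_nat[OF k(1), of "Suc j"] by (simp del: of_nat_Suc)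
    then show thesis using that[of "Polynomial.coeff m j"] j(1) poly_overD[OF m(2)] by blast
  next
    case False
    then have b: "t \<noteq> 0" "D t / t \<in> k" using gen by auto
    define b where "b = D t / t"
    have Dt: "D t = b * t" using b by (simp add: b_def)
    define q where "q = map_poly D m + Polynomial.smult b (pCons 0 (pderiv m)) - Polynomial.smult (of_nat d * b) m"
    have coeff_q: "Polynomial.coeff q j = D (Polynomial.coeff m j) + b * of_nat j * Polynomial.coeff m j
        - of_nat d * b * Polynomial.coeff m j" for j
      by (cases j) (simp_all add: q_def coeff_pderiv)
    have "b \<in> L" using b L(3) by (auto simp: b_def)
    have "q = 0"
    proof (rule deg0)
      show "poly_over L q"
        unfolding q_def using Dm \<open>b \<in> L\<close> m(2) subfield_of_nat[OF L(1)] subfield_type_ringD[OF L(1)]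
        by (auto intro!: poly_over_add[OF L(1)] poly_over_diff[OF L(1)] poly_over_smult[OF L(1)] poly_over_pCons[OF L(1)])
      show "poly q t = 0" using Dmt m(3) by (simp add: q_def Dt mult_ac)
      fix j assume "d \<le> j"
      then show "Polynomial.coeff q j = 0"
        using md high by (cases "j = d") (simp_all add: coeff_q)
    qed
    then have D_coeff: "D (Polynomial.coeff m i) = (of_nat d - of_nat i) * b * Polynomial.coeff m i"
      using coeff_q[of i] by (simp add: algebra_simps)
    have nz: "Polynomial.coeff m i \<noteq> 0" using i kD by auto
    then have "D (Polynomial.coeff m i) / Polynomial.coeff m i = (of_nat d - of_nat i) * b"
      by (simp add: D_coeff)
    also have "\<dots> \<in> k"
      unfolding b_def by (intro kD(5,6) subfield_of_nat[OF k(1)] b(2))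
    finally show thesis using that[of "Polynomial.coeff m i"] i nz poly_overD[OF m(2)] by blast
  qed
qed

end

locale derivation_char_0 = derivation D for D :: "'f::{field_char_0,field_gcd} \<Rightarrow> 'f"
begin

text \<open>
  If \<open>m\<close> is the minimal polynomial of \<open>y\<close>, then \<open>0 = (m(y))' = m'(y) y'\<close>, because the coefficients of \<open>m\<close>
  are constants, and \<open>m'(y) \<noteq> 0\<close> in characteristic zero.
\<close>

lemma constant_of_algebraic_over_constants:
  assumes "algebraic_over constants y"
  shows "D y = 0"
proof -
  obtain m where m: "Polynomial.lead_coeff m = 1" "poly_over constants m" "poly m y = 0"
    and min: "\<And>q. poly_over constants q \<Longrightarrow> poly q y = 0 \<Longrightarrow> Polynomial.degree q < Polynomial.degree m \<Longrightarrow> q = 0"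
    using minimal_polynomial_exists[OF subfield_constants assms(1)] by metis
  have "map_poly D m = 0"
    using m(2) by (auto simp: poly_eq_iff poly_over_def constants_def)
  then have "poly (pderiv m) y * D y = 0"
    using D_poly[of m y] m(3) by simp
  moreover have "poly (pderiv m) y \<noteq> 0"
  proof
    assume 0: "poly (pderiv m) y = 0"
    have "Polynomial.degree m \<noteq> 0"
    proof
      assume "Polynomial.degree m = 0"
      then obtain a where "m = [:a:]" by (metis degree_eq_zeroE)
      with m show False by simp
    qed
    then obtain d where d: "Polynomial.degree m = Suc d" by (metis not0_implies_Suc)
    have "Polynomial.degree (pderiv m) \<le> d"
      by (rule degree_le) (simp add: coeff_pderiv coeff_eq_0 d)
    then have "pderiv m = 0"
      using min[OF poly_over_pderiv[OF subfield_constants m(2)] 0] d by simp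
    then have "Polynomial.coeff (pderiv m) d = 0" by simp
    then have "(of_nat (Suc d) :: 'f) = 0" using m(1) d by (simp add: coeff_pderiv del: of_nat_Suc)
    then show False using of_nat_neq_0 by blast
  qed
  ultimately show ?thesis by simp
qed

end

section \<open>Constants of the derivation in a rational function field\<close>

lemma poly_eq_of_transcendental:
  assumes "subfield k type_ring" "\<not> algebraic_over k y" "poly_over k p" "poly_over k q" "poly p y = poly q y"
  shows "p = q"
  using assms poly_over_diff[of k p q] by (auto simp: algebraic_over_def)

text \<open>
  Since \<open>y\<close> is transcendental, \<open>k(y)\<close> is a rational function field and has the derivation \<open>d/dy\<close>. Two
  representations of an element of \<open>k(y)\<close> define the same formal fraction, so the formal derivative
  of a fraction shows that the value is well defined.
\<close>

lemma formal_derivative_exists: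
  fixes k :: "'f::field set"
  assumes k: "subfield k type_ring" and y: "\<not> algebraic_over k y"
  obtains dd where "\<And>A B. poly_over k A \<Longrightarrow> poly_over k B \<Longrightarrow> poly B y \<noteq> 0 \<Longrightarrow>
    dd (poly A y / poly B y) = poly (pderiv A * B - A * pderiv B) y / poly (B * B) y"
proof -
  let ?rep = "\<lambda>x A B. poly_over k A \<and> poly_over k B \<and> poly B y \<noteq> 0 \<and> x = poly A y / poly B y"
  let ?val = "\<lambda>A B. poly (pderiv A * B - A * pderiv B) y / poly (B * B) y"
  have unique: "?val A B = ?val A' B'" if *: "?rep x A B" "?rep x A' B'" for x A B A' B'
  proof -
    have "poly (A * B') y = poly (A' * B) y" using * by (auto simp: field_simps)
    then have "A * B' = A' * B"
      using * by (intro poly_eq_of_transcendental[OF k y] poly_over_mult[OF k]) auto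
    moreover have nz: "B \<noteq> 0" "B' \<noteq> 0" using * by auto
    ultimately have "Fraction_Field.Fract A B = Fraction_Field.Fract A' B'" by (simp add: eq_fract)
    then have "rat_deriv (Fraction_Field.Fract A B) = rat_deriv (Fraction_Field.Fract A' B')" by simp
    then have "(pderiv A * B - A * pderiv B) * (B' * B') = (pderiv A' * B' - A' * pderiv B') * (B * B)"
      using nz by (simp add: rat_deriv_Fract eq_fract)
    from arg_cong[OF this, of "\<lambda>p. poly p y"] show ?thesis
      using * by (simp add: frac_eq_eq)
  qed
  define dd where "dd x = (SOME v. \<exists>A B. ?rep x A B \<and> v = ?val A B)" for x
  show thesis
  proof (rule that[of dd])
    fix A B assume "poly_over k A" "poly_over k B" "poly B y \<noteq> 0"
    then have AB: "?rep (poly A y / poly B y) A B" by simp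
    then have "\<exists>v A' B'. ?rep (poly A y / poly B y) A' B' \<and> v = ?val A' B'" by blast
    from someI_ex[OF this] obtain A' B' where "?rep (poly A y / poly B y) A' B'" "dd (poly A y / poly B y) = ?val A' B'"
      unfolding dd_def by blast
    with unique[OF AB] show "dd (poly A y / poly B y) = ?val A B" by metis
  qed
qed

text \<open>
  This is used for a function that satisfies the rules of a derivation only on the generated field:
  the commutator of a derivation with a multiple of \<open>d/dy\<close>.
\<close>

lemma derivation_vanishes_on_generated:
  fixes E :: "'f::field \<Rightarrow> 'f" and H :: "'f set"
  assumes add: "\<And>x z. x \<in> generate_field type_ring H \<Longrightarrow> z \<in> generate_field type_ring H \<Longrightarrow> E (x + z) = E x + E z"
    and mult: "\<And>x z. x \<in> generate_field type_ring H \<Longrightarrow> z \<in> generate_field type_ring H \<Longrightarrow> E (x * z) = E x * z + x * E z"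
    and H: "\<And>h. h \<in> H \<Longrightarrow> E h = 0" and x: "x \<in> generate_field type_ring H"
  shows "E x = 0"
proof -
  note L = subfield_type_ringD[OF subfield_generate[of H]]
  have E1: "E 1 = 0" using mult[OF L(2) L(2)] by (metis add_cancel_right_right mult.left_neutral mult.right_neutral)
  have E0: "E 0 = 0" using add[OF L(1) L(1)] by (metis add_cancel_right_right add.right_neutral)
  show ?thesis
    using x
  proof induction
    case (a_inv h)
    then show ?case using add[of h "- h"] L(4) E0 by simp
  next
    case (m_inv h)
    then show ?case using mult[of h "inverse h"] L(7) E1 by simp
  qed (simp_all add: E1 H add mult)
qed

context derivation_char_0
begin

text \<open>
  Write \<open>\<partial>\<close> for \<open>d/dy\<close> on \<open>k(y)\<close>. The derivations \<open>D\<close> and \<open>(D y) \<partial>\<close> of \<open>k(y)\<close> commute: their commutator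
  is a derivation, it vanishes on \<open>k\<close>, which \<open>D\<close> maps to itself, and it vanishes at \<open>y\<close> since
  \<open>D y = P(y)/Q(y)\<close> has constant coefficients. Applied to \<open>D s = b\<close> or \<open>D s = b s\<close> with \<open>b \<in> k\<close>, this shows
  that \<open>f = (D y) \<partial>s\<close>, respectively \<open>f = (D y) \<partial>s / s\<close>, is a constant. The definition of \<open>f\<close> is then a
  polynomial relation for \<open>y\<close> over \<open>k\<close>, hence an identity of polynomials.
\<close>

theorem first_integral:
  assumes k: "subfield k type_ring" "D ` k \<subseteq> k" "constants \<subseteq> k"
    and y: "\<not> algebraic_over k y"
    and PQ: "poly_over constants P" "poly_over constants Q" "poly Q y \<noteq> 0" "D y = poly P y / poly Q y" "D y \<noteq> 0"
    and s: "s \<in> generate_field type_ring (insert y k)" "s \<notin> k" "D s \<in> k \<or> (s \<noteq> 0 \<and> D s / s \<in> k)"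
  obtains f A B where "f \<noteq> 0" "A \<noteq> 0" "B \<noteq> 0"
    "P * (pderiv A * B - A * pderiv B) = Polynomial.smult f (Q * (B * B)) \<or>
     P * (pderiv A * B - A * pderiv B) = Polynomial.smult f (Q * (A * B))"
proof -
  let ?L = "generate_field type_ring (insert y k)"
  note kD = subfield_type_ringD[OF k(1)]
  note LD = subfield_type_ringD[OF subfield_generate[of "insert y k"]]
  have kL: "x \<in> ?L" if "x \<in> k" for x using that by (auto intro: generate_field.incl)
  have yL: "y \<in> ?L" by (auto intro: generate_field.incl)
  have PQk: "poly_over k P" "poly_over k Q" using PQ k(3) poly_over_mono by blast+
  have L_cases: "\<exists>A B. poly_over k A \<and> poly_over k B \<and> poly B y \<noteq> 0 \<and> x = poly A y / poly B y"
    if "x \<in> ?L" for x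
    using that unfolding generate_field_insert[OF k(1)] by blast
  obtain dd where dd: "\<And>A B. poly_over k A \<Longrightarrow> poly_over k B \<Longrightarrow> poly B y \<noteq> 0 \<Longrightarrow>
    dd (poly A y / poly B y) = poly (pderiv A * B - A * pderiv B) y / poly (B * B) y"
    using formal_derivative_exists[OF k(1) y] by blast
  have dd_add: "dd (x + z) = dd x + dd z" and dd_mult: "dd (x * z) = dd x * z + x * dd z"
    if xz: "x \<in> ?L" "z \<in> ?L" for x z
  proof -
    obtain A B C E where *: "poly_over k A" "poly_over k B" "poly B y \<noteq> 0" "x = poly A y / poly B y"
      "poly_over k C" "poly_over k E" "poly E y \<noteq> 0" "z = poly C y / poly E y"
      using L_cases[OF xz(1)] L_cases[OF xz(2)] by metis
    have e: "x + z = poly (A * E + C * B) y / poly (B * E) y" "x * z = poly (A * C) y / poly (B * E) y"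
      unfolding *(4,8) using *(3,7) by (simp_all add: add_frac_eq)
    have d: "dd (poly (A * E + C * B) y / poly (B * E) y)
        = poly (pderiv (A * E + C * B) * (B * E) - (A * E + C * B) * pderiv (B * E)) y / poly ((B * E) * (B * E)) y"
      "dd (poly (A * C) y / poly (B * E) y)
        = poly (pderiv (A * C) * (B * E) - (A * C) * pderiv (B * E)) y / poly ((B * E) * (B * E)) y"
      by (rule dd; use * in \<open>simp add: poly_over_add[OF k(1)] poly_over_mult[OF k(1)]\<close>)+
    have d': "dd x = poly (pderiv A * B - A * pderiv B) y / poly (B * B) y"
      "dd z = poly (pderiv C * E - C * pderiv E) y / poly (E * E) y"
      using * dd by auto
    show "dd (x + z) = dd x + dd z"
      unfolding e d d' using *(3,7) by (simp add: pderiv_add pderiv_mult field_simps)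
    show "dd (x * z) = dd x * z + x * dd z"
      unfolding e d d' unfolding *(4,8) using *(3,7) by (simp add: pderiv_mult field_simps)
  qed
  have dd_k: "dd c = 0" if "c \<in> k" for c
    using dd[of "[:c:]" 1] that by (simp add: poly_over_const[OF k(1)] poly_over_1[OF k(1)])
  have dd_y: "dd y = 1"
    using dd[of "[:0, 1:]" 1] kD by (simp add: poly_over_const[OF k(1)] poly_over_1[OF k(1)] poly_over_pCons[OF k(1)] pderiv_pCons)
  have DyL: "D y \<in> ?L"
    unfolding PQ(4) using LD(8) poly_in_subfield[OF subfield_generate _ yL] poly_over_mono PQk kL by (meson subsetI)
  have D_L: "D x \<in> ?L" if "x \<in> ?L" for x
    using stable_generate_field[of "insert y k"] DyL k(2) kL that by blast
  have map_D_0: "map_poly D p = 0" if "poly_over constants p" for p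
    using that by (auto simp: poly_eq_iff poly_over_def constants_def)
  have Dr: "D (D y) = D y * dd (D y)"
  proof -
    have "D (poly P y / poly Q y) = D y * (poly (pderiv P * Q - P * pderiv Q) y / poly (Q * Q) y)"
      using PQ(3) by (simp add: D_divide D_poly map_D_0[OF PQ(1)] map_D_0[OF PQ(2)] algebra_simps)
    also have "poly (pderiv P * Q - P * pderiv Q) y / poly (Q * Q) y = dd (D y)"
      unfolding PQ(4) by (rule dd[symmetric]) (use PQk PQ(3) in auto)
    finally show ?thesis using PQ(4) by simp
  qed
  \<comment> \<open>The commutator of \<open>D\<close> and \<open>(D y) \<partial>\<close>.\<close>
  define C where "C x = D (D y * dd x) - D y * dd (D x)" for x
  have commute: "D (D y * dd x) = D y * dd (D x)" if "x \<in> ?L" for x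
  proof -
    have "C x = 0"
    proof (rule derivation_vanishes_on_generated[OF _ _ _ that])
      fix u v assume uv: "u \<in> ?L" "v \<in> ?L"
      show "C (u + v) = C u + C v"
        using uv D_L by (simp add: C_def D_add dd_add algebra_simps)
      show "C (u * v) = C u * v + u * C v"
        using uv D_L LD(6) by (simp add: C_def D_add D_mult dd_add dd_mult algebra_simps)
    next
      fix h assume "h \<in> insert y k"
      then show "C h = 0" using k(2) dd_k dd_y Dr by (auto simp: C_def)
    qed
    then show ?thesis by (simp add: C_def)
  qed
  obtain A B where AB: "poly_over k A" "poly_over k B" "poly B y \<noteq> 0" "s = poly A y / poly B y"
    using L_cases[OF s(1)] by blast
  let ?W = "pderiv A * B - A * pderiv B"
  have dds: "dd s = poly ?W y / poly (B * B) y" unfolding AB(4) by (rule dd[OF AB(1-3)])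
  have B0: "B \<noteq> 0" using AB by auto
  have A0: "A \<noteq> 0" using AB s(2) kD(1) by auto
  \<comment> \<open>An element of \<open>k(y)\<close> with \<open>\<partial>s = 0\<close> is a quotient of leading coefficients, so it lies in \<open>k\<close>.\<close>
  have dds0: "dd s \<noteq> 0"
  proof
    assume "dd s = 0"
    then have "poly ?W y = poly 0 y" using dds AB(3) by simp
    then have "?W = 0"
      using AB by (intro poly_eq_of_transcendental[OF k(1) y] poly_over_diff[OF k(1)] poly_over_mult[OF k(1)]
          poly_over_pderiv[OF k(1)] poly_over_0[OF k(1)])
    then obtain c where c: "A = Polynomial.smult c B" using wronskian_eq_0[OF B0] by blast
    then have "c = Polynomial.coeff A (Polynomial.degree B) / Polynomial.lead_coeff B" using B0 by simp
    then have "c \<in> k" using kD(8) poly_overD[OF AB(1)] poly_overD[OF AB(2)] by blast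
    then show False using s(2) AB c by simp
  qed
  note over = poly_over_smult[OF k(1)] poly_over_diff[OF k(1)] poly_over_mult[OF k(1)] poly_over_pderiv[OF k(1)]
  show thesis
  proof (cases "D s \<in> k")
    case True
    define f where "f = D y * dd s"
    have "D f = 0" unfolding f_def commute[OF s(1)] using dd_k[OF True] by simp
    then have fk: "f \<in> k" using k(3) by (auto simp: constants_def)
    have "poly (P * ?W) y = poly (Polynomial.smult f (Q * (B * B))) y"
      using PQ(3) AB(3) by (simp add: f_def dds PQ(4) field_simps)
    then have "P * ?W = Polynomial.smult f (Q * (B * B))"
      using PQk AB fk by (intro poly_eq_of_transcendental[OF k(1) y] over)
    then show thesis using that[of f A B] A0 B0 dds0 PQ(5) by (simp add: f_def)
  next
    case False
    then have b: "s \<noteq> 0" "D s / s \<in> k" using s(3) by auto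
    define b where "b = D s / s"
    have Ds: "D s = b * s" using b by (simp add: b_def)
    define f where "f = D y * dd s / s"
    have "D (D y * dd s) = b * (D y * dd s)"
      unfolding commute[OF s(1)] using Ds dd_mult[OF kL s(1), of b] dd_k[of b] b by (simp add: b_def)
    then have "D f = 0" unfolding f_def using b(1) by (simp add: D_divide Ds)
    then have fk: "f \<in> k" using k(3) by (auto simp: constants_def)
    have "poly A y \<noteq> 0" using b(1) AB by auto
    moreover have "f = (poly P y / poly Q y) * (poly ?W y / poly (B * B) y) / (poly A y / poly B y)"
      unfolding f_def dds PQ(4) unfolding AB(4) ..
    moreover have "p / q * (w / (b * b)) / (a / b) = p * w / (q * (a * b))"
      if "a \<noteq> 0" "b \<noteq> 0" "q \<noteq> 0" for p q w a b :: 'f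
      using that by (simp add: field_simps)
    ultimately have "f = poly P y * poly ?W y / (poly Q y * (poly A y * poly B y))"
      using AB(3) PQ(3) by (simp only: poly_mult)
    then have "poly (P * ?W) y = poly (Polynomial.smult f (Q * (A * B))) y"
      using PQ(3) AB(3) \<open>poly A y \<noteq> 0\<close> by (simp only: poly_mult poly_smult) simp
    then have "P * ?W = Polynomial.smult f (Q * (A * B))"
      using PQk AB fk by (intro poly_eq_of_transcendental[OF k(1) y] over)
    then show thesis using that[of f A B] A0 B0 dds0 PQ(5) b(1) by (simp add: f_def)
  qed
qed

end

section \<open>Necessity for a field that is a type\<close>

definition elementary_integral :: "'c::field poly fract \<Rightarrow> bool" where
  "elementary_integral R \<longleftrightarrow> (\<exists>z. 1 / R = rat_deriv z \<or>
     (\<exists>a. a \<noteq> 0 \<and> z \<noteq> 0 \<and> 1 / R = 1 / (const_rat a * z) * rat_deriv z))"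

text \<open>
  The fields \<open>F i\<close> form the given tower with all constants adjoined. They are stable under \<open>D\<close> because the
  fields \<open>k i\<close> are. Enlarging the constants is what makes the first integral \<open>f\<close> of the previous
  section an element of the base field, although the extension may contain constants that are not
  in \<open>C\<close>.
\<close>

theorem elementary_integral_of_liouvillian_solution:
  fixes emb :: "'c::{alg_closed_field,field_char_0} \<Rightarrow> 'f::{field_char_0,field_gcd}"
  assumes ext: "liouvillian_extension (type_ring :: 'c ring) (\<lambda>_. 0) (type_ring :: 'f ring) D emb"
    and y: "rat_value type_ring emb R y (D y)" "D y \<noteq> 0"
  shows "elementary_integral R"
proof -
  have emb: "emb \<in> ring_hom type_ring type_ring" and D: "differential_field (type_ring :: 'f ring) D"
    and D_emb: "D (emb c) = emb 0" for c
    using ext by (simp_all add: liouvillian_extension_def differential_extension_def)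
  interpret alg_closed_embedding emb
    using ring_hom_memE[OF emb] by unfold_locales simp_all
  interpret derivation_char_0 D
    using differential_field.der_add[OF D] differential_field.der_mult[OF D] by unfold_locales simp_all
  obtain n :: nat and t and k where
    k0: "k 0 = range emb" and kn: "k n = (UNIV :: 'f set)"
    and stable: "\<And>i. i \<le> n \<Longrightarrow> D ` k i \<subseteq> k i" and sub: "\<And>i. i \<le> n \<Longrightarrow> subfield (k i) type_ring"
    and step: "\<And>i. i \<in> {1..n} \<Longrightarrow> k i = generate_field type_ring (insert (t i) (k (i - 1)))"
    and gen: "\<And>i. i \<in> {1..n} \<Longrightarrow> liouvillian_generator type_ring D (k (i - 1)) (t i)"
    using ext by (auto simp: liouvillian_extension_def differential_subfield_def)
  define F where "F = rec_nat constants (\<lambda>i S. generate_field type_ring (insert (t (Suc i)) S))"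
  have F0: "F 0 = constants" and F_Suc: "F (Suc i) = generate_field type_ring (insert (t (Suc i)) (F i))" for i
    by (simp_all add: F_def)
  have F_sub: "subfield (F i) type_ring" for i
    by (cases i) (simp_all add: F0 F_Suc subfield_constants subfield_generate)
  have F_const: "constants \<subseteq> F i" for i
    by (induction i) (auto simp: F0 F_Suc intro: generate_field.incl)
  interpret E: field "type_ring :: 'f ring" by (rule field_from_type_algebra)
  have kF: "i \<le> n \<Longrightarrow> k i \<subseteq> F i" for i
  proof (induction i)
    case 0
    show ?case using D_emb by (auto simp: k0 F0 constants_def)
  next
    case (Suc i)
    then have "k (Suc i) = generate_field type_ring (insert (t (Suc i)) (k i))" using step[of "Suc i"] by simp
    moreover have "k i \<subseteq> F i" using Suc by simp
    ultimately show ?case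
      unfolding F_Suc by (simp only:, intro E.mono_generate_field) auto
  qed
  have F_stable: "i \<le> n \<Longrightarrow> D ` F i \<subseteq> F i" for i
  proof (induction i)
    case 0
    then show ?case by (auto simp: F0 constants_def)
  next
    case (Suc i)
    have "t (Suc i) \<in> k (Suc i)" using step[of "Suc i"] Suc.prems by (auto intro: generate_field.incl)
    then have "D (t (Suc i)) \<in> F (Suc i)" using stable[OF Suc.prems] kF[OF Suc.prems] by blast
    moreover have "D ` F i \<subseteq> F (Suc i)"
      using Suc by (auto simp: F_Suc intro: generate_field.incl)
    ultimately show ?case unfolding F_Suc by (intro stable_generate_field) auto
  qed
  have "algebraic_over (F n) y"
    using kF[of n] kn by (intro algebraic_over_self[OF F_sub]) auto
  define i where "i = (LEAST i. algebraic_over (F i) y)"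
  have i: "algebraic_over (F i) y" "i \<le> n"
    unfolding i_def using \<open>algebraic_over (F n) y\<close> by (rule LeastI, rule Least_le)
  have "i \<noteq> 0" using i(1) constant_of_algebraic_over_constants y(2) F0 by metis
  then obtain j where j: "i = Suc j" by (metis not0_implies_Suc)
  have ny: "\<not> algebraic_over (F j) y" using not_less_Least[of j "\<lambda>i. algebraic_over (F i) y"] j i_def by auto
  have y_alg: "algebraic_over (generate_field type_ring (insert (t i) (F j))) y"
    using i(1) by (simp add: j F_Suc)
  have nt: "\<not> algebraic_over (F j) (t i)"
    using algebraic_over_trans[OF F_sub _ y_alg] ny by blast
  have "\<not> algebraic_over (k j) (t i)" using nt kF[of j] i(2) j algebraic_over_mono by auto
  then have "D (t i) \<in> k j \<or> (t i \<noteq> 0 \<and> D (t i) / t i \<in> k j)"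
    using gen[of i] i(2) j algebraic_type_ring_iff[OF sub[of j], of "t i"]
    by (auto simp: liouvillian_generator_def divide_inverse)
  \<comment> \<open>A transcendental generator is of one of the first two kinds.\<close>
  then have gen': "D (t i) \<in> F j \<or> (t i \<noteq> 0 \<and> D (t i) / t i \<in> F j)"
    using kF[of j] i(2) j by auto
  obtain p q where pq: "R = Fraction_Field.Fract p q" "q \<noteq> 0" "poly (lift_poly q) y \<noteq> 0"
     "D y = poly (lift_poly p) y / poly (lift_poly q) y"
    using y(1) by (auto simp: rat_value_def poly_value_type_ring divide_inverse)
  have p0: "p \<noteq> 0" using y(2) pq(4) by auto
  have over: "poly_over constants (lift_poly r)" for r
    using D_emb by (simp add: poly_over_def constants_def)
  let ?L = "generate_field type_ring (insert y (F j))"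
  have L: "subfield ?L type_ring" by (rule subfield_generate)
  have FL: "F j \<subseteq> ?L" "y \<in> ?L" by (auto intro: generate_field.incl)
  have "constants \<subseteq> ?L" using F_const FL(1) by blast
  then have "poly (lift_poly r) y \<in> ?L" for r
    using FL(2) by (intro poly_in_subfield[OF L] poly_over_mono[OF over])
  then have "D y \<in> ?L" unfolding pq(4) using subfield_type_ringD(8)[OF L] by blast
  then have L_stable: "D ` ?L \<subseteq> ?L"
    using F_stable[of j] i(2) j FL by (intro stable_generate_field) auto
  obtain s where s: "s \<in> ?L" "s \<notin> F j" "D s \<in> F j \<or> (s \<noteq> 0 \<and> D s / s \<in> F j)"
    using transcendental_generator_descends[OF F_sub F_stable L L_stable FL(1)
        algebraic_over_exchange[OF F_sub y_alg ny] nt gen'] i(2) j by auto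
  obtain f A B where fAB: "f \<noteq> 0" "A \<noteq> 0" "B \<noteq> 0"
    "lift_poly p * (pderiv A * B - A * pderiv B) = Polynomial.smult f (lift_poly q * (B * B)) \<or>
     lift_poly p * (pderiv A * B - A * pderiv B) = Polynomial.smult f (lift_poly q * (A * B))"
    using first_integral[OF F_sub F_stable F_const ny over over pq(3,4) y(2) s] i(2) j by auto
  from fAB(4) show ?thesis
    using descend_primitive[OF p0 pq(2) fAB(3,1)] descend_exponential[OF p0 pq(2) fAB(2,3,1)]
    unfolding pq(1) elementary_integral_def by blast
qed

section \<open>Transport along isomorphisms of fields\<close>

locale field_isomorphism = E: field E + E': field E'
  for E :: "'e ring" and E' :: "'g ring" +
  fixes h :: "'e \<Rightarrow> 'g"
  assumes iso: "h \<in> ring_iso E E'"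
begin

sublocale h: ring_hom_ring E E' h
  using iso by (intro ring_hom_ringI2 E.ring_axioms E'.ring_axioms) (simp add: ring_iso_def)

lemma inj_h: "inj_on h (carrier E)" and image_carrier: "h ` carrier E = carrier E'"
  using iso by (auto simp: ring_iso_def bij_betw_def)

lemma h_eq_zero_iff: "x \<in> carrier E \<Longrightarrow> h x = \<zero>\<^bsub>E'\<^esub> \<longleftrightarrow> x = \<zero>\<^bsub>E\<^esub>"
  using inj_onD[OF inj_h, of x "\<zero>\<^bsub>E\<^esub>"] by auto

lemma h_inv: "x \<in> carrier E \<Longrightarrow> x \<noteq> \<zero>\<^bsub>E\<^esub> \<Longrightarrow> h (inv\<^bsub>E\<^esub> x) = inv\<^bsub>E'\<^esub> (h x)"
  using E'.comm_inv_char[of "h x" "h (inv\<^bsub>E\<^esub> x)"] E.field_Units h.hom_mult[of x "inv\<^bsub>E\<^esub> x", symmetric]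
  by simp

lemma image_subfield: "subfield S E \<Longrightarrow> subfield (h ` S) E'"
  by (intro h.img_is_subfield(2)) auto

lemma image_generate_field:
  assumes "H \<subseteq> carrier E"
  shows "h ` generate_field E H = generate_field E' (h ` H)"
proof
  show "generate_field E' (h ` H) \<subseteq> h ` generate_field E H"
    using assms
    by (intro E'.generate_field_min_subfield1 image_subfield E.generate_field_is_subfield)
       (auto intro!: imageI generate_field.incl)
  show "h ` generate_field E H \<subseteq> generate_field E' (h ` H)"
  proof (rule image_subsetI)
    fix x assume "x \<in> generate_field E H"
    then show "h x \<in> generate_field E' (h ` H)"
      by induction (use E.generate_field_in_carrier[OF assms] h_eq_zero_iff h_inv in
          \<open>auto intro: generate_field.intros\<close>)
  qed
qed

lemma image_algebraic:
  assumes S: "subfield S E" and x: "x \<in> carrier E" "(E.algebraic over S) x"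
  shows "(E'.algebraic over (h ` S)) (h x)"
proof -
  obtain p where p: "p \<in> carrier (S[X]\<^bsub>E\<^esub>)" "p \<noteq> []" "E.eval p x = \<zero>\<^bsub>E\<^esub>"
    using E.algebraicE[OF subfieldE(1)[OF S] x] .
  have set: "set p \<subseteq> S" "hd p \<noteq> \<zero>\<^bsub>E\<^esub>"
    using p by (auto simp: univ_poly_carrier[symmetric] polynomial_def)
  have "set p \<subseteq> carrier E" using set(1) subfieldE(3)[OF S] by blast
  moreover from this have "h (hd p) \<noteq> \<zero>\<^bsub>E'\<^esub>" using set(2) p(2) h_eq_zero_iff hd_in_set by blast
  ultimately show ?thesis
    using p(2,3) set(1) h.eval_hom'[OF x(1), of p]
    by (intro E'.algebraicI[of "map h p"])
       (auto simp: univ_poly_carrier[symmetric] polynomial_def hd_map)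
qed

lemma poly_value_image:
  assumes "y \<in> carrier E" "\<And>c. \<iota> c \<in> carrier E"
  shows "poly_value E' (\<lambda>c. h (\<iota> c)) p (h y) = h (poly_value E \<iota> p y)"
proof -
  have "set (map \<iota> (rev (Polynomial.coeffs p))) \<subseteq> carrier E" using assms(2) by auto
  from h.eval_hom'[OF assms(1) this] show ?thesis by (simp add: poly_value_def comp_def)
qed

lemma rat_value_image:
  assumes "y \<in> carrier E" "\<And>c. \<iota> c \<in> carrier E" "rat_value E \<iota> R y v"
  shows "rat_value E' (\<lambda>c. h (\<iota> c)) R (h y) (h v)"
proof -
  have closed: "poly_value E \<iota> p y \<in> carrier E" for p
    using assms(1,2) by (auto simp: poly_value_def intro!: E.eval_in_carrier)
  obtain p q where "R = Fraction_Field.Fract p q" "q \<noteq> 0" "poly_value E \<iota> q y \<noteq> \<zero>\<^bsub>E\<^esub>"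
    "v = poly_value E \<iota> p y \<otimes>\<^bsub>E\<^esub> inv\<^bsub>E\<^esub> (poly_value E \<iota> q y)"
    using assms(3) by (auto simp: rat_value_def)
  then show ?thesis
    unfolding rat_value_def poly_value_image[OF assms(1,2)]
    using closed h_eq_zero_iff h_inv E.field_Units
    by (intro exI[of _ p] exI[of _ q]) auto
qed

text \<open>
  All data of the tower are images under the isomorphism; this is used both to move a given extension
  to a type and to move the extension \<open>C(X)\<close> to the type of elements that is prescribed.
\<close>

lemma liouvillian_extension_image:
  assumes ext: "liouvillian_extension K d E D \<iota>"
    and D': "\<And>x. x \<in> carrier E \<Longrightarrow> D' (h x) = h (D x)"
  shows "liouvillian_extension K d E' D' (\<lambda>c. h (\<iota> c))"
proof -
  have K: "differential_field K d" and D: "differential_field E D" and \<iota>: "\<iota> \<in> ring_hom K E"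
    and D\<iota>: "\<And>c. c \<in> carrier K \<Longrightarrow> D (\<iota> c) = \<iota> (d c)"
    using ext by (simp_all add: liouvillian_extension_def differential_extension_def)
  interpret D: differential_field E D by (fact D)
  have \<iota>_closed: "\<iota> c \<in> carrier E" if "c \<in> carrier K" for c
    using ring_hom_memE(1)[OF \<iota> that] .
  obtain n :: nat and t and k where
    gen_E: "carrier E = generate_field E (\<iota> ` carrier K \<union> t ` {1..n})"
    and k0: "k 0 = \<iota> ` carrier K" and kn: "k n = carrier E"
    and sub: "\<And>i. i \<le> n \<Longrightarrow> subfield (k i) E" and stable: "\<And>i. i \<le> n \<Longrightarrow> D ` k i \<subseteq> k i"
    and step: "\<And>i. i \<in> {1..n} \<Longrightarrow> k i = generate_field E (insert (t i) (k (i - 1)))"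
    and gen: "\<And>i. i \<in> {1..n} \<Longrightarrow> liouvillian_generator E D (k (i - 1)) (t i)"
    using ext by (auto simp: liouvillian_extension_def differential_subfield_def)
  have k_closed: "k i \<subseteq> carrier E" if "i \<le> n" for i using subfieldE(3)[OF sub[OF that]] .
  have t_closed: "t i \<in> carrier E" if "i \<in> {1..n}" for i
    using step[OF that] k_closed[of i] that by (auto intro: generate_field.incl)
  have "differential_field E' D'"
  proof
    fix x y assume "x \<in> carrier E'" "y \<in> carrier E'"
    then obtain u v where uv: "x = h u" "y = h v" "u \<in> carrier E" "v \<in> carrier E"
      using image_carrier by blast
    show "D' x \<in> carrier E'" using uv D' D.der_closed by simp
    have "D' (h (u \<oplus>\<^bsub>E\<^esub> v)) = h (D u) \<oplus>\<^bsub>E'\<^esub> h (D v)"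
      unfolding D'[OF E.add.m_closed[OF uv(3,4)]] D.der_add[OF uv(3,4)] using uv D.der_closed by simp
    then show "D' (x \<oplus>\<^bsub>E'\<^esub> y) = D' x \<oplus>\<^bsub>E'\<^esub> D' y" using uv D' by simp
    have "D' (h (u \<otimes>\<^bsub>E\<^esub> v)) = h (D u) \<otimes>\<^bsub>E'\<^esub> h v \<oplus>\<^bsub>E'\<^esub> h u \<otimes>\<^bsub>E'\<^esub> h (D v)"
      unfolding D'[OF E.m_closed[OF uv(3,4)]] D.der_mult[OF uv(3,4)] using uv D.der_closed by simp
    then show "D' (x \<otimes>\<^bsub>E'\<^esub> y) = D' x \<otimes>\<^bsub>E'\<^esub> y \<oplus>\<^bsub>E'\<^esub> x \<otimes>\<^bsub>E'\<^esub> D' y" using uv D' by simp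
  qed
  moreover have "(\<lambda>c. h (\<iota> c)) \<in> ring_hom K E'"
    using ring_hom_trans[OF \<iota> h.homh] by (simp add: comp_def)
  ultimately have "differential_extension K d E' D' (\<lambda>c. h (\<iota> c))"
    using K D\<iota> D' \<iota>_closed by (simp add: differential_extension_def)
  moreover have "\<exists>(n::nat) (t :: nat \<Rightarrow> 'g) (k :: nat \<Rightarrow> 'g set).
        carrier E' = generate_field E' ((\<lambda>c. h (\<iota> c)) ` carrier K \<union> t ` {1..n}) \<and>
        k 0 = (\<lambda>c. h (\<iota> c)) ` carrier K \<and> k n = carrier E' \<and>
        (\<forall>i\<le>n. differential_subfield (k i) E' D') \<and>
        (\<forall>i\<in>{1..n}. k i = generate_field E' (insert (t i) (k (i - 1))) \<and>
                     liouvillian_generator E' D' (k (i - 1)) (t i))"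
  proof (intro exI[of _ n] exI[of _ "\<lambda>i. h (t i)"] exI[of _ "\<lambda>i. h ` k i"] conjI allI ballI impI)
    have "carrier E' = h ` generate_field E (\<iota> ` carrier K \<union> t ` {1..n})"
      using gen_E image_carrier by simp
    also have "\<dots> = generate_field E' (h ` (\<iota> ` carrier K \<union> t ` {1..n}))"
      using \<iota>_closed t_closed by (intro image_generate_field) auto
    finally show "carrier E' = generate_field E' ((\<lambda>c. h (\<iota> c)) ` carrier K \<union> (\<lambda>i. h (t i)) ` {1..n})"
      by (simp add: image_Un image_image)
    show "h ` k 0 = (\<lambda>c. h (\<iota> c)) ` carrier K" by (simp add: k0 image_image)
    show "h ` k n = carrier E'" using kn image_carrier by simp
  next
    fix i assume i: "i \<le> n"
    have "D' (h x) \<in> h ` k i" if "x \<in> k i" for x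
      using that D' k_closed[OF i] stable[OF i] by (metis image_eqI image_subset_iff subsetD)
    then show "differential_subfield (h ` k i) E' D'"
      using image_subfield[OF sub[OF i]] by (auto simp: differential_subfield_def)
  next
    fix i assume i: "i \<in> {1..n}"
    then have i': "i - 1 \<le> n" by auto
    show "h ` k i = generate_field E' (insert (h (t i)) (h ` k (i - 1)))"
      using step[OF i] image_generate_field[of "insert (t i) (k (i - 1))"] t_closed[OF i] k_closed[OF i'] by simp
    consider "D (t i) \<in> k (i - 1)" | "t i \<noteq> \<zero>\<^bsub>E\<^esub>" "D (t i) \<otimes>\<^bsub>E\<^esub> inv\<^bsub>E\<^esub> t i \<in> k (i - 1)"
      | "(E.algebraic over k (i - 1)) (t i)"
      using gen[OF i] by (auto simp: liouvillian_generator_def)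
    then show "liouvillian_generator E' D' (h ` k (i - 1)) (h (t i))"
    proof cases
      case 1
      then show ?thesis using D' t_closed[OF i] by (simp add: liouvillian_generator_def)
    next
      case 2
      have "D' (h (t i)) \<otimes>\<^bsub>E'\<^esub> inv\<^bsub>E'\<^esub> h (t i) = h (D (t i) \<otimes>\<^bsub>E\<^esub> inv\<^bsub>E\<^esub> t i)"
        using D' t_closed[OF i] 2 D.der_closed E.field_Units by (simp add: h_inv)
      then show ?thesis using 2 t_closed[OF i] h_eq_zero_iff by (simp add: liouvillian_generator_def)
    next
      case 3
      then show ?thesis
        using image_algebraic[OF sub[OF i'] t_closed[OF i]] by (simp add: liouvillian_generator_def)
    qed
  qed
  ultimately show ?thesis unfolding liouvillian_extension_def by blast
qed

end

section \<open>A type that carries a counterexample\<close>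

definition counterexample ::
    "'c::field poly fract \<Rightarrow> 'e ring \<Rightarrow> ('e \<Rightarrow> 'e) \<Rightarrow> ('c \<Rightarrow> 'e) \<Rightarrow> 'e \<Rightarrow> bool" where
  "counterexample R E D \<iota> y \<longleftrightarrow> \<not> elementary_integral R \<and>
     liouvillian_extension (type_ring :: 'c ring) (\<lambda>_. 0) E D \<iota> \<and>
     y \<in> carrier E \<and> rat_value E \<iota> R y (D y) \<and> D y \<noteq> \<zero>\<^bsub>E\<^esub>"

text \<open>
  A type cannot depend on a field that is fixed inside a proof, but it may depend on one that is
  chosen globally. The chosen field is isomorphic to the extension in some counterexample to
  necessity, if there is any; otherwise every field that contains \<open>C\<close> will do, and \<open>C\<close> itself has room
  in the sum type. The embedding of \<open>C\<close> fixes the characteristic.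
\<close>

definition test_field_axioms :: "('c::field + 'e) ring \<Rightarrow> bool" where
  "test_field_axioms F \<longleftrightarrow> field F \<and> (\<exists>\<iota>. \<iota> \<in> ring_hom (type_ring :: 'c ring) F) \<and>
     ((\<exists>(R :: 'c poly fract) (E :: 'e ring) D \<iota> y. counterexample R E D \<iota> y) \<longrightarrow>
      (\<exists>(R :: 'c poly fract) (E :: 'e ring) D \<iota> y h. counterexample R E D \<iota> y \<and> h \<in> ring_iso E F))"

lemma counterexample_field:
  assumes "counterexample R E D \<iota> y"
  shows "field E" "\<iota> \<in> ring_hom type_ring E"
  using assms differential_field.axioms(1)
  by (auto simp: counterexample_def liouvillian_extension_def differential_extension_def)

lemma test_field_exists: "\<exists>F :: ('c::field + 'e) ring. test_field_axioms F"
proof (cases "\<exists>(R :: 'c poly fract) (E :: 'e ring) D \<iota> y. counterexample R E D \<iota> y")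
  case True
  then obtain R :: "'c poly fract" and E :: "'e ring" and D \<iota> y where c: "counterexample R E D \<iota> y"
    by blast
  interpret E: field E by (rule counterexample_field(1)[OF c])
  let ?F = "image_ring (Inr :: 'e \<Rightarrow> 'c + 'e) E"
  have "field ?F" by (rule E.inj_imp_image_ring_is_field) simp
  moreover have iso: "Inr \<in> ring_iso E ?F" by (rule inj_imp_image_ring_iso) simp
  moreover have "Inr \<circ> \<iota> \<in> ring_hom type_ring ?F"
    by (rule ring_hom_trans[OF counterexample_field(2)[OF c]]) (use iso in \<open>simp add: ring_iso_def\<close>)
  ultimately have "test_field_axioms ?F" using c unfolding test_field_axioms_def by blast
  then show ?thesis by blast
next
  case False
  interpret C: field "type_ring :: 'c ring" by (rule field_from_type_algebra)
  let ?F = "image_ring (Inl :: 'c \<Rightarrow> 'c + 'e) type_ring"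
  have "field ?F" by (rule C.inj_imp_image_ring_is_field) simp
  moreover have "Inl \<in> ring_iso type_ring ?F" by (rule inj_imp_image_ring_iso) simp
  ultimately have "test_field_axioms ?F"
    using False unfolding test_field_axioms_def ring_iso_def by blast
  then show ?thesis by blast
qed

definition test_field_ring :: "('c::field + 'e) ring" where
  "test_field_ring = (SOME F. test_field_axioms F)"

lemma test_field_ring: "test_field_axioms test_field_ring"
  unfolding test_field_ring_def by (rule someI_ex[OF test_field_exists])

lemma field_test_field_ring: "field test_field_ring"
  by (rule test_field_ring[unfolded test_field_axioms_def, THEN conjunct1])

typedef (overloaded) ('c::field, 'e) test_field = "carrier (test_field_ring :: ('c + 'e) ring)"
proof -
  interpret field "test_field_ring :: ('c + 'e) ring" by (rule field_test_field_ring)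
  show "\<exists>x. x \<in> carrier (test_field_ring :: ('c + 'e) ring)" using zero_closed by blast
qed

setup_lifting type_definition_test_field

instantiation test_field :: (field, type) field
begin

interpretation field test_field_ring by (rule field_test_field_ring)

lift_definition zero_test_field :: "('a, 'b) test_field" is "\<zero>\<^bsub>test_field_ring\<^esub>" by simp

lift_definition one_test_field :: "('a, 'b) test_field" is "\<one>\<^bsub>test_field_ring\<^esub>" by simp

lift_definition plus_test_field :: "('a, 'b) test_field \<Rightarrow> ('a, 'b) test_field \<Rightarrow> ('a, 'b) test_field"
  is "\<lambda>x y. x \<oplus>\<^bsub>test_field_ring\<^esub> y" by simp

lift_definition minus_test_field :: "('a, 'b) test_field \<Rightarrow> ('a, 'b) test_field \<Rightarrow> ('a, 'b) test_field"
  is "\<lambda>x y. x \<ominus>\<^bsub>test_field_ring\<^esub> y" by simp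

lift_definition times_test_field :: "('a, 'b) test_field \<Rightarrow> ('a, 'b) test_field \<Rightarrow> ('a, 'b) test_field"
  is "\<lambda>x y. x \<otimes>\<^bsub>test_field_ring\<^esub> y" by simp

lift_definition uminus_test_field :: "('a, 'b) test_field \<Rightarrow> ('a, 'b) test_field"
  is "\<lambda>x. \<ominus>\<^bsub>test_field_ring\<^esub> x" by simp

lift_definition inverse_test_field :: "('a, 'b) test_field \<Rightarrow> ('a, 'b) test_field"
  is "\<lambda>x. if x = \<zero>\<^bsub>test_field_ring\<^esub> then \<zero>\<^bsub>test_field_ring\<^esub> else inv\<^bsub>test_field_ring\<^esub> x"
  by (simp add: field_Units)

definition divide_test_field :: "('a, 'b) test_field \<Rightarrow> ('a, 'b) test_field \<Rightarrow> ('a, 'b) test_field"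
  where "divide_test_field x y = x * inverse y"

instance
proof
  fix a b c :: "('a, 'b) test_field"
  show "a * b * c = a * (b * c)" by transfer (simp add: m_assoc)
  show "a * b = b * a" by transfer (simp add: m_comm)
  show "1 * a = a" by transfer simp
  show "a + b + c = a + (b + c)" by transfer (simp add: a_assoc)
  show "a + b = b + a" by transfer (simp add: a_comm)
  show "0 + a = a" by transfer simp
  show "- a + a = 0" by transfer (simp add: l_neg)
  show "a - b = a + - b" by transfer (simp add: minus_eq)
  show "(a + b) * c = a * c + b * c" by transfer (simp add: l_distr)
  show "(0 :: ('a, 'b) test_field) \<noteq> 1" by transfer simp
  show "a \<noteq> 0 \<Longrightarrow> inverse a * a = 1" by transfer (simp add: field_Units)
  show "a div b = a * inverse b" by (simp add: divide_test_field_def)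
  show "inverse (0 :: ('a, 'b) test_field) = 0" by transfer simp
qed

end

lemma Abs_test_field_iso: "Abs_test_field \<in> ring_iso test_field_ring (type_ring :: ('c::field, 'e) test_field ring)"
proof -
  interpret field "test_field_ring :: ('c + 'e) ring" by (rule field_test_field_ring)
  show ?thesis
  proof (intro ring_iso_memI)
    show "bij_betw (Abs_test_field :: _ \<Rightarrow> ('c, 'e) test_field) (carrier test_field_ring) (carrier type_ring)"
      by (rule bij_betw_byWitness[of _ Rep_test_field])
         (use Rep_test_field in \<open>auto simp: Abs_test_field_inverse Rep_test_field_inverse\<close>)
  qed (simp_all add: times_test_field.abs_eq plus_test_field.abs_eq one_test_field.abs_eq eq_onp_same_args)
qed

lemma test_field_embedding: "\<exists>emb :: 'c::field \<Rightarrow> ('c, 'e) test_field. field_embedding emb"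
proof -
  obtain \<iota> where "\<iota> \<in> ring_hom (type_ring :: 'c ring) (test_field_ring :: ('c + 'e) ring)"
    using test_field_ring unfolding test_field_axioms_def by blast
  then have "Abs_test_field \<circ> \<iota> \<in> ring_hom type_ring type_ring"
    using ring_hom_trans Abs_test_field_iso unfolding ring_iso_def by blast
  from ring_hom_memE[OF this] have "field_embedding (Abs_test_field \<circ> \<iota>)"
    by unfold_locales simp_all
  then show ?thesis by blast
qed

instance test_field :: ("{field, ring_char_0}", type) field_char_0
proof
  obtain emb :: "'a \<Rightarrow> ('a, 'b) test_field" where "field_embedding emb"
    using test_field_embedding by blast
  then interpret field_embedding emb .
  show "inj (of_nat :: nat \<Rightarrow> ('a, 'b) test_field)"
    by (rule injI) (simp flip: emb_of_nat)
qed

text \<open>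
  The usual structure of a field as a Euclidean ring, needed for greatest common divisors of
  polynomials over it.
\<close>

instantiation test_field :: (field, type)
  "{unique_euclidean_ring, normalization_euclidean_semiring, normalization_semidom_multiplicative}"
begin

definition [simp]: "normalize_test_field = (normalize_field :: ('a, 'b) test_field \<Rightarrow> _)"
definition [simp]: "unit_factor_test_field = (unit_factor_field :: ('a, 'b) test_field \<Rightarrow> _)"
definition [simp]: "modulo_test_field = (mod_field :: ('a, 'b) test_field \<Rightarrow> _)"
definition [simp]: "euclidean_size_test_field = (euclidean_size_field :: ('a, 'b) test_field \<Rightarrow> _)"
definition [simp]: "division_segment (x :: ('a, 'b) test_field) = 1"

instance
  by standard (simp_all add: dvd_field_iff field_split_simps split: if_splits)

end

instantiation test_field :: (field, type) euclidean_ring_gcd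
begin

definition gcd_test_field :: "('a, 'b) test_field \<Rightarrow> ('a, 'b) test_field \<Rightarrow> ('a, 'b) test_field" where
  "gcd_test_field = Euclidean_Algorithm.gcd"
definition lcm_test_field :: "('a, 'b) test_field \<Rightarrow> ('a, 'b) test_field \<Rightarrow> ('a, 'b) test_field" where
  "lcm_test_field = Euclidean_Algorithm.lcm"
definition Gcd_test_field :: "('a, 'b) test_field set \<Rightarrow> ('a, 'b) test_field" where
  "Gcd_test_field = Euclidean_Algorithm.Gcd"
definition Lcm_test_field :: "('a, 'b) test_field set \<Rightarrow> ('a, 'b) test_field" where
  "Lcm_test_field = Euclidean_Algorithm.Lcm"

instance
  by standard (simp_all add: gcd_test_field_def lcm_test_field_def Gcd_test_field_def Lcm_test_field_def)

end

instance test_field :: (field, type) field_gcd ..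

text \<open>
  A counterexample would give one whose extension is, up to isomorphism, the field of elements of a
  type, which the previous results exclude.
\<close>

theorem liouvillian_solution_imp_elementary_integral:
  fixes R :: "'c::{alg_closed_field,field_char_0} poly fract"
  assumes "has_nonconstant_liouvillian_solution TYPE('e) R"
  shows "elementary_integral R"
proof (rule ccontr)
  assume "\<not> elementary_integral R"
  with assms have "\<exists>(R :: 'c poly fract) (E :: 'e ring) D \<iota> y. counterexample R E D \<iota> y"
    unfolding has_nonconstant_liouvillian_solution_def counterexample_def by blast
  moreover have "test_field_axioms (test_field_ring :: ('c + 'e) ring)" by (rule test_field_ring)
  ultimately obtain R :: "'c poly fract" and E :: "'e ring" and D \<iota> y h where
    c: "counterexample R E D \<iota> y" and h: "h \<in> ring_iso E (test_field_ring :: ('c + 'e) ring)"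
    unfolding test_field_axioms_def by blast
  define g where "g = (Abs_test_field :: _ \<Rightarrow> ('c, 'e) test_field) \<circ> h"
  have "g \<in> ring_iso E type_ring"
    unfolding g_def using ring_iso_set_trans[OF h Abs_test_field_iso] .
  then interpret field_isomorphism E type_ring g
    unfolding field_isomorphism_def field_isomorphism_axioms_def
    using counterexample_field(1)[OF c] field_from_type_algebra by blast
  define D' where "D' x = g (D (inv_into (carrier E) g x))" for x
  have D': "D' (g x) = g (D x)" if "x \<in> carrier E" for x
    using inv_into_f_f[OF inj_h that] by (simp add: D'_def)
  have c': "\<not> elementary_integral R" "liouvillian_extension type_ring (\<lambda>_. 0) E D \<iota>"
    "y \<in> carrier E" "rat_value E \<iota> R y (D y)" "D y \<noteq> \<zero>\<^bsub>E\<^esub>"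
    using c by (simp_all add: counterexample_def)
  have D: "differential_field E D"
    using c'(2) by (simp add: liouvillian_extension_def differential_extension_def)
  have "liouvillian_extension type_ring (\<lambda>_. 0) type_ring D' (\<lambda>c. g (\<iota> c))"
    by (rule liouvillian_extension_image[OF c'(2) D'])
  moreover have "\<iota> c \<in> carrier E" for c
    using ring_hom_memE(1)[OF counterexample_field(2)[OF c], of c] by simp
  then have "rat_value type_ring (\<lambda>c. g (\<iota> c)) R (g y) (D' (g y))"
    unfolding D'[OF c'(3)] using rat_value_image[OF c'(3) _ c'(4)] by blast
  moreover have "D' (g y) \<noteq> 0"
    unfolding D'[OF c'(3)] using h_eq_zero_iff differential_field.der_closed[OF D c'(3)] c'(5) by simp
  ultimately have "elementary_integral R"
    by (rule elementary_integral_of_liouvillian_solution)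
  with c'(1) show False by blast
qed

section \<open>Sufficiency\<close>

text \<open>
  A field of characteristic zero is infinite, so pairs of its elements can be encoded by single
  elements. Hence so can polynomials, as lists of coefficients together with their length, and
  fractions of polynomials.
\<close>

lemma rat_function_injects:
  fixes g :: "'c::field_char_0 \<Rightarrow> 'e"
  assumes "inj g"
  obtains h :: "'c poly fract \<Rightarrow> 'e" where "inj h"
proof -
  have "infinite (UNIV :: 'c set)"
    by (rule infinite_UNIV_char_0)
  then obtain pair :: "'c \<times> 'c \<Rightarrow> 'c" where pair: "inj pair"
    using card_of_Times_same_infinite[of "UNIV :: 'c set"]
    unfolding card_of_ordIso[symmetric] by (auto simp: bij_betw_def)
  define code :: "'c list \<Rightarrow> 'c" where "code = rec_list 0 (\<lambda>x _ r. pair (x, r))"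
  have code_eq: "xs = ys" if "length xs = length ys" "code xs = code ys" for xs ys
    using that
  proof (induction xs ys rule: list_induct2)
    case (Cons x xs y ys)
    then show ?case using injD[OF pair] by (auto simp: code_def)
  qed simp
  define code_poly :: "'c poly \<Rightarrow> 'c" where
    "code_poly p = pair (of_nat (length (Polynomial.coeffs p)), code (Polynomial.coeffs p))" for p
  have code_poly: "inj code_poly"
  proof (rule injI)
    fix p q assume "code_poly p = code_poly q"
    then have "length (Polynomial.coeffs p) = length (Polynomial.coeffs q)"
      "code (Polynomial.coeffs p) = code (Polynomial.coeffs q)"
      unfolding code_poly_def by (auto dest: injD[OF pair])
    then show "p = q" using code_eq by (simp add: coeffs_eq_iff)
  qed
  let ?frac = "\<lambda>(p :: 'c poly, q). Fraction_Field.Fract p q"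
  have "\<exists>x. r = ?frac x" for r :: "'c poly fract"
  proof (cases r)
    case (Fract p q)
    then have "r = ?frac (p, q)" by simp
    then show ?thesis by blast
  qed
  then have "surj ?frac" unfolding surj_def by blast
  then have "inj (inv_into UNIV ?frac)" by (rule surj_imp_inj_inv)
  then have "inj (g \<circ> pair \<circ> map_prod code_poly code_poly \<circ> inv_into UNIV ?frac)"
    by (intro inj_compose assms pair prod.inj_map code_poly)
  then show thesis by (rule that)
qed

text \<open>
  The extension is \<open>C(X)\<close> with the derivation \<open>R d/dX\<close>, and the tower is \<open>C \<subseteq> C(z) \<subseteq> C(X)\<close>. If \<open>z = u/v\<close>, then
  \<open>X\<close> is a root of the polynomial \<open>u - z v\<close> over \<open>C(z)\<close>, which is not zero because \<open>z \<notin> C\<close>.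
\<close>

theorem elementary_integral_imp_liouvillian_solution:
  fixes R :: "'c::{alg_closed_field,field_char_0} poly fract" and g :: "'c \<Rightarrow> 'e"
  assumes "R \<noteq> 0" "elementary_integral R" "inj g"
  shows "has_nonconstant_liouvillian_solution TYPE('e) R"
proof -
  define D :: "'c poly fract \<Rightarrow> 'c poly fract" where "D f = R * rat_deriv f" for f
  let ?X = "Fraction_Field.Fract [:0, 1:] 1 :: 'c poly fract"
  interpret derivation D
    by unfold_locales (simp_all add: D_def rat_deriv_add rat_deriv_mult algebra_simps)
  interpret field_embedding "const_rat :: 'c \<Rightarrow> 'c poly fract"
    by unfold_locales (simp_all add: One_fract_def one_pCons mult.commute)
  have D_const: "D (const_rat c) = 0" for c by (simp add: D_def rat_deriv_const)
  have DX: "D ?X = R" by (simp add: D_def rat_deriv_X)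
  have value_X: "poly (lift_poly p) ?X = Fraction_Field.Fract p 1" for p
    by (induction p) (simp_all add: map_poly_pCons Zero_fract_def)
  obtain p q where pq: "R = Fraction_Field.Fract p q" "q \<noteq> 0" by (cases R)
  have R_value: "rat_value type_ring const_rat R ?X (D ?X)"
    unfolding rat_value_def
    by (intro exI[of _ p] exI[of _ q])
       (use pq in \<open>simp add: poly_value_type_ring value_X DX Zero_fract_def eq_fract divide_inverse\<close>)
  obtain z a where z: "1 / R = rat_deriv z \<or> (a \<noteq> 0 \<and> z \<noteq> 0 \<and> 1 / R = 1 / (const_rat a * z) * rat_deriv z)"
    using assms(2) unfolding elementary_integral_def by blast
  have Dz: "D z = 1 \<or> (z \<noteq> 0 \<and> D z = const_rat a * z)"
    using z assms(1) by (auto simp: D_def field_simps)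
  have Dz0: "D z \<noteq> 0"
    using z assms(1) by (auto simp: D_def field_simps)
  let ?C = "range const_rat :: 'c poly fract set"
  let ?K = "generate_field type_ring (insert z ?C)"
  have C: "subfield ?C type_ring" by (rule subfield_range_emb)
  have K: "subfield ?K type_ring" by (rule subfield_generate)
  have CK: "?C \<subseteq> ?K" "z \<in> ?K" by (auto intro: generate_field.incl)
  have everything: "S = UNIV" if "subfield S type_ring" "?C \<subseteq> S" "?X \<in> S" for S
  proof -
    have "poly (lift_poly p) ?X \<in> S" for p
      using that by (intro poly_in_subfield[OF that(1)]) (auto simp: poly_over_def)
    then have "Fraction_Field.Fract p 1 / Fraction_Field.Fract q 1 \<in> S" for p q
      unfolding value_X using subfield_type_ringD(8)[OF that(1)] by blast
    moreover have "\<exists>p q. r = Fraction_Field.Fract p 1 / Fraction_Field.Fract q 1" for r :: "'c poly fract"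
      by (cases r) auto
    ultimately show ?thesis by (metis UNIV_eq_I)
  qed
  have top: "generate_field type_ring (insert ?X ?K) = UNIV" (is "?L = _")
  proof (rule everything)
    have "?K \<subseteq> ?L" by (auto intro: generate_field.incl)
    then show "?C \<subseteq> ?L" using CK by blast
  qed (auto intro: subfield_generate generate_field.incl)
  have all: "generate_field type_ring (?C \<union> {z, ?X}) = UNIV"
    by (rule everything) (auto intro: subfield_generate generate_field.incl)
  have "D ` ?K \<subseteq> ?K"
  proof (rule stable_generate_field)
    have "const_rat a \<in> ?K" using CK(1) by blast
    then have "D z \<in> ?K"
      using Dz CK(2) subfield_type_ringD(2,6)[OF K] by (elim disjE conjE) simp_all
    then show "D ` insert z ?C \<subseteq> ?K" using subfield_type_ringD(1)[OF K] D_const by auto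
  qed
  have X_algebraic: "algebraic_over ?K ?X"
  proof -
    obtain u v where uv: "z = Fraction_Field.Fract u v" "v \<noteq> 0" by (cases z)
    define w where "w = lift_poly u - Polynomial.smult z (lift_poly v)"
    have "poly w ?X = 0"
      using uv by (simp add: w_def value_X Zero_fract_def eq_fract)
    moreover have "w \<noteq> 0"
    proof
      assume "w = 0"
      then have "Polynomial.coeff w (Polynomial.degree v) = 0" by simp
      then have *: "const_rat (Polynomial.coeff u (Polynomial.degree v)) = z * const_rat (Polynomial.lead_coeff v)"
        by (simp add: w_def)
      have "D z * const_rat (Polynomial.lead_coeff v) = 0"
        using arg_cong[OF *, of D] by (simp add: D_mult D_const)
      then have "D z = 0" using uv(2) by simp
      with Dz0 show False by simp
    qed
    moreover have "poly_over ?K w"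
      unfolding w_def using CK
      by (intro poly_over_diff[OF K] poly_over_smult[OF K]) (auto simp: poly_over_def)
    ultimately show ?thesis by (auto simp: algebraic_over_def)
  qed
  have ext: "liouvillian_extension (type_ring :: 'c ring) (\<lambda>_. 0) type_ring D const_rat"
  proof -
    have "differential_field (type_ring :: 'c ring) (\<lambda>_. 0)"
      by (intro differential_field.intro differential_field_axioms.intro field_from_type_algebra) simp_all
    moreover have "differential_field type_ring D"
      by (intro differential_field.intro differential_field_axioms.intro field_from_type_algebra)
         (simp_all only: carrier_type_ring add_type_ring mult_type_ring D_add D_mult UNIV_I)
    moreover have "const_rat \<in> ring_hom (type_ring :: 'c ring) type_ring"
      by (rule ring_hom_memI)
         (simp_all only: carrier_type_ring add_type_ring mult_type_ring one_type_ring emb_add emb_mult emb_one UNIV_I)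
    ultimately have "differential_extension (type_ring :: 'c ring) (\<lambda>_. 0) type_ring D const_rat"
      unfolding differential_extension_def using D_const emb_zero by simp
    moreover have "\<exists>(n::nat) (t :: nat \<Rightarrow> 'c poly fract) (k :: nat \<Rightarrow> 'c poly fract set).
        carrier type_ring = generate_field type_ring (const_rat ` carrier type_ring \<union> t ` {1..n}) \<and>
        k 0 = const_rat ` carrier type_ring \<and> k n = carrier type_ring \<and>
        (\<forall>i\<le>n. differential_subfield (k i) type_ring D) \<and>
        (\<forall>i\<in>{1..n}. k i = generate_field type_ring (insert (t i) (k (i - 1))) \<and>
                     liouvillian_generator type_ring D (k (i - 1)) (t i))"
    proof (intro exI conjI)
      let ?t = "\<lambda>i::nat. if i = 1 then z else ?X"
      let ?k = "\<lambda>i::nat. if i = 0 then ?C else if i = 1 then ?K else UNIV"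
      have two: "{1..2} = {1, 2::nat}" by auto
      have t12: "?t ` {1..2} = {z, ?X}" unfolding two by auto
      show "carrier type_ring = generate_field type_ring (const_rat ` carrier type_ring \<union> ?t ` {1..2})"
        unfolding t12 using all by simp
      show "?k 0 = const_rat ` carrier type_ring" "?k 2 = carrier type_ring" by simp_all
      have "subfield UNIV (type_ring :: 'c poly fract ring)" by (rule subfield_type_ringI) auto
      then show "\<forall>i\<le>2. differential_subfield (?k i) type_ring D"
        using C K \<open>D ` ?K \<subseteq> ?K\<close> D_const emb_zero by (auto simp: differential_subfield_def)
      have "liouvillian_generator type_ring D ?C z"
        using Dz
      proof
        assume "D z = 1"
        then show ?thesis using subfield_type_ringD(2)[OF C] by (simp add: liouvillian_generator_def)
      next
        assume "z \<noteq> 0 \<and> D z = const_rat a * z"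
        then have "z \<noteq> 0" "D z * inverse z = const_rat a" by (simp_all add: mult.assoc)
        then have "z \<noteq> 0" "D z * inverse z \<in> ?C" by auto
        then show ?thesis unfolding liouvillian_generator_def by simp
      qed
      moreover have "liouvillian_generator type_ring D ?K ?X"
        using X_algebraic algebraic_type_ring_iff[OF K] by (simp add: liouvillian_generator_def)
      ultimately show "\<forall>i\<in>{1..2}. ?k i = generate_field type_ring (insert (?t i) (?k (i - 1))) \<and>
                     liouvillian_generator type_ring D (?k (i - 1)) (?t i)"
        unfolding two using top by simp
    qed
    ultimately show ?thesis unfolding liouvillian_extension_def by blast
  qed
  obtain h :: "'c poly fract \<Rightarrow> 'e" where h: "inj h" using rat_function_injects[OF assms(3)] .
  let ?E = "image_ring h type_ring"
  interpret F: field "type_ring :: 'c poly fract ring" by (rule field_from_type_algebra)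
  have inj: "inj_on h (carrier type_ring)" using h by simp
  interpret field_isomorphism type_ring ?E h
    unfolding field_isomorphism_def field_isomorphism_axioms_def
    using F.inj_imp_image_ring_is_field[OF inj] inj_imp_image_ring_iso[OF inj] F.field_axioms by blast
  define D' where "D' x = h (D (inv_into UNIV h x))" for x
  have D': "D' (h x) = h (D x)" for x using h by (simp add: D'_def)
  have "liouvillian_extension (type_ring :: 'c ring) (\<lambda>_. 0) ?E D' (\<lambda>c. h (const_rat c))"
    by (rule liouvillian_extension_image[OF ext D'])
  moreover have "rat_value ?E (\<lambda>c. h (const_rat c)) R (h ?X) (D' (h ?X))"
    unfolding D' by (rule rat_value_image[OF _ _ R_value]) simp_all
  moreover have "D' (h ?X) \<noteq> \<zero>\<^bsub>?E\<^esub>" "h ?X \<in> carrier ?E"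
    using h_eq_zero_iff[of R] assms(1) h.hom_closed[of ?X] by (simp_all add: D' DX)
  ultimately show ?thesis
    unfolding has_nonconstant_liouvillian_solution_def by blast
qed

section \<open>The equivalence\<close>

theorem proposition3p1:
  fixes R :: "'c::{alg_closed_field, field_char_0} poly fract"
  assumes "R \<noteq> 0"
    and "\<exists>f :: 'c \<Rightarrow> 'e. inj f"
  shows "has_nonconstant_liouvillian_solution TYPE('e) R \<longleftrightarrow>
    (\<exists>z :: 'c poly fract.
       1 / R = rat_deriv z \<or>
       (\<exists>a :: 'c. a \<noteq> 0 \<and> z \<noteq> 0 \<and> 1 / R = 1 / (const_rat a * z) * rat_deriv z))"
  using liouvillian_solution_imp_elementary_integral[of R, where 'e='e]
    elementary_integral_imp_liouvillian_solution[OF assms(1)] assms(2)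
  unfolding elementary_integral_def by blast

end
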